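(* For every integer $k\geq 2$ there exist a constant $C>0$ and a family $(Y_n)_{n\in\mathbb N}$ of pure $k$-dimensional simplicial complexes, where $Y_n$ has $n$ vertices and complete $(k-1)$-skeleton, such that: (1) all nontrivial eigenvalues of $\Delta^{\mathrm{up}}_{k-1}(Y_n)$ lie in $[1-C/\sqrt n,\,1+C/\sqrt n]$; (2) there is a cochain $a_n\in C^{k-1}(Y_n;\mathbb Z_2)$ with $\|[a_n]\|\geq \tfrac12-o(1)$ and $\|\delta a_n\|\leq C\log n/n$ (as $n\to\infty$); (3) the reduced integral homology groups satisfy $\tilde H_i(Y_n;\mathbb Z)=0$ for all $i\leq k-1$.
   Context: Complexes have linearly ordered vertex sets; $X_i$ is the set of $i$-faces, $[F:G]$ the oriented incidence number ($[F:G]=(-1)^j$ if $F\setminus G=\{v_j\}$ with $F=\{v_0<\dots<v_i\}$, $0$ if $G\not\subseteq F$). $\deg(F)$ is the number of $k$-faces containing $F$; pure means all maximal faces have dimension $k$. Coboundary: $(\delta f)(H)=\sum_{G}[H:G]f(G)$ (over $\mathbb R$ or $\mathbb Z_2$). $A_{k-1}(X)$: $X_{k-1}\times X_{k-1}$ matrix with entry $[F:F\cap G][G:F\cap G]$ if $|F\cap G|=k-1$ and $F\cup G\in X_k$, else $0$. $\Delta^{\mathrm{up}}_{k-1}(X)=I-D_{k-1}^{-1}A_{k-1}(X)$ with $D_{k-1}$ the diagonal degree matrix; it is self-adjoint for $\langle f,g\rangle=\sum_{F\in X_{k-1}}\deg(F)f(F)g(F)$, and its nontrivial eigenvalues are the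 eigenvalues of its restriction to the orthogonal complement (w.r.t. this inner product) of $B^{k-1}(X;\mathbb R)=\operatorname{im}\delta_{k-2}$. For $\mathbb Z_2$-cochains, $\|f\|=|\{F\in X_i: f(F)=1\}|/|X_i|$ for $f\in C^i(X;\mathbb Z_2)$, and $\|[f]\|=\min\{\|f+\delta g\|: g\in C^{i-1}(X;\mathbb Z_2)\}$.
   Formalization: The properties of Y_n are asserted for all sufficiently large n rather than every n: no pure k-dimensional complex on n ≤ k vertices exists, and the finitely many other small n are covered by complete k-skeleta after enlarging C. *)

theory Defs
  imports Complex_Main
begin

text \<open>Complexes on the vertex set {0..<n} (linearly ordered by the order of nat).
  Faces are finite sets of vertices; the empty face is included (it is the unique
  (-1)-face, used for reduced homology).  A face of dimension i has i+1 elements.\<close>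

definition simplicial_complex :: "nat \<Rightarrow> nat set set \<Rightarrow> bool" where
  "simplicial_complex n X \<longleftrightarrow>
     (\<forall>F\<in>X. F \<subseteq> {..<n}) \<and> (\<forall>F\<in>X. \<forall>G. G \<subseteq> F \<longrightarrow> G \<in> X) \<and> (\<forall>v<n. {v} \<in> X)"

text \<open>faces with exactly m elements, i.e. the (m-1)-faces\<close>
definition cfaces :: "nat set set \<Rightarrow> nat \<Rightarrow> nat set set" where
  "cfaces X m = {F \<in> X. card F = m}"

definition pure_dim :: "nat \<Rightarrow> nat set set \<Rightarrow> bool" where
  "pure_dim k X \<longleftrightarrow> (\<forall>F\<in>X. card F \<le> k + 1) \<and> (\<forall>F\<in>X. \<exists>H\<in>X. card H = k + 1 \<and> F \<subseteq> H)"

definition complete_skeleton :: "nat \<Rightarrow> nat \<Rightarrow> nat set set \<Rightarrow> bool" where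
  "complete_skeleton n k X \<longleftrightarrow> (\<forall>F. F \<subseteq> {..<n} \<and> card F \<le> k \<longrightarrow> F \<in> X)"

definition inc :: "nat set \<Rightarrow> nat set \<Rightarrow> 'a::ring_1" where
  "inc F G = (if G \<subseteq> F \<and> card F = card G + 1
     then (-1) ^ card {x\<in>F. x < the_elem (F - G)} else 0)"

definition deg :: "nat set set \<Rightarrow> nat \<Rightarrow> nat set \<Rightarrow> nat" where
  "deg X k F = card {H \<in> cfaces X (k + 1). F \<subseteq> H}"

definition adjA :: "nat set set \<Rightarrow> nat \<Rightarrow> nat set \<Rightarrow> nat set \<Rightarrow> real" where
  "adjA X k F G = (if card (F \<inter> G) = k - 1 \<and> F \<union> G \<in> cfaces X (k + 1)
     then inc F (F \<inter> G) * inc G (F \<inter> G) else 0)"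

definition up_lap :: "nat set set \<Rightarrow> nat \<Rightarrow> (nat set \<Rightarrow> real) \<Rightarrow> nat set \<Rightarrow> real" where
  "up_lap X k f F = f F - (1 / real (deg X k F)) * (\<Sum>G\<in>cfaces X k. adjA X k F G * f G)"

definition winner :: "nat set set \<Rightarrow> nat \<Rightarrow> (nat set \<Rightarrow> real) \<Rightarrow> (nat set \<Rightarrow> real) \<Rightarrow> real" where
  "winner X k f g = (\<Sum>F\<in>cfaces X k. real (deg X k F) * f F * g F)"

definition cobdry :: "nat set set \<Rightarrow> nat \<Rightarrow> (nat set \<Rightarrow> real) \<Rightarrow> nat set \<Rightarrow> real" where
  "cobdry X m g H = (\<Sum>G\<in>cfaces X m. inc H G * g G)"

definition nontrivial_eig :: "nat set set \<Rightarrow> nat \<Rightarrow> real \<Rightarrow> bool" where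
  "nontrivial_eig X k lam \<longleftrightarrow> (\<exists>f. (\<exists>F\<in>cfaces X k. f F \<noteq> 0)
      \<and> (\<forall>g. winner X k f (cobdry X (k - 1) g) = 0)
      \<and> (\<forall>F\<in>cfaces X k. up_lap X k f F = lam * f F))"

text \<open>Z_2 cochains as boolean functions; coboundary of g on faces with m elements\<close>
definition cob2 :: "nat set set \<Rightarrow> nat \<Rightarrow> (nat set \<Rightarrow> bool) \<Rightarrow> nat set \<Rightarrow> bool" where
  "cob2 X m g H = odd (card {G\<in>cfaces X m. inc H G \<noteq> (0::int) \<and> g G})"

definition norm2 :: "nat set set \<Rightarrow> nat \<Rightarrow> (nat set \<Rightarrow> bool) \<Rightarrow> real" where
  "norm2 X m f = real (card {F\<in>cfaces X m. f F}) / real (card (cfaces X m))"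

definition cnorm2 :: "nat set set \<Rightarrow> nat \<Rightarrow> (nat set \<Rightarrow> bool) \<Rightarrow> real" where
  "cnorm2 X m f = Inf {norm2 X m (\<lambda>F. f F \<noteq> cob2 X (m - 1) g F) | g. True}"

definition bdry :: "nat set set \<Rightarrow> nat \<Rightarrow> (nat set \<Rightarrow> int) \<Rightarrow> nat set \<Rightarrow> int" where
  "bdry X m c G = (\<Sum>F\<in>cfaces X m. inc F G * c F)"

text \<open>reduced integral homology in dimension i vanishes (the empty face gives the
  augmentation): every i-cycle is an (i+1)-boundary\<close>
definition reduced_hom_vanishes :: "nat set set \<Rightarrow> nat \<Rightarrow> bool" where
  "reduced_hom_vanishes X i \<longleftrightarrow> (\<forall>c. (\<forall>G\<in>cfaces X i. bdry X (i + 1) c G = 0) \<longrightarrow>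
      (\<exists>b. \<forall>F\<in>cfaces X (i + 1). c F = bdry X (i + 2) b F))"

end

theory Submission
  imports "HOL-Algebra.Algebraic_Closure_Type" "HOL-Library.Z2"
    "HOL-Combinatorics.Multiset_Permutations" "HOL-Analysis.Convex" Defs
begin

text \<open>
  The construction is explicit. Label the vertices by nonzero elements \<open>x v\<close> of a field \<open>K\<close> with
  \<open>2 ^ m\<close> elements, \<open>n / 16 < 2 ^ m \<le> n / 8\<close>, using every label a bounded number of times, and let
  \<open>\<chi>\<close> be a nontrivial additive character of \<open>K\<close>. The cochain is \<open>a(G) = \<chi>(\<Prod>v\<in>G. x v)\<close>, written
  multiplicatively, so that \<open>\<delta>a(H) = \<chi>(e(H))\<close> where \<open>e(H)\<close> is the sum of the products of the labels
  over all facets of \<open>H\<close>. The \<open>k\<close>-faces of \<open>Y\<close> are the sets with \<open>\<delta>a(H) = 1\<close>, together with the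
  exceptional ones, which contain the vertex 0 or a nonempty \<open>T\<close> with \<open>e(T) = 0\<close>. Since
  \<open>e(T \<union> {v}) = \<Prod>T + x v * e(T)\<close>, a set that is not exceptional becomes so by adding only boundedly
  many vertices; hence \<open>\<delta>a\<close> is supported on an \<open>O(1/n)\<close> fraction of the \<open>k\<close>-faces.

  All sets of size at most \<open>k + 1\<close> through the vertex 0 are present, so cycles are bounded by cones.

  As \<open>e(T \<union> {u, v}) = \<Prod>T * (x u + x v) + e(T) * x u * x v\<close>, the adjacency matrix of the link of a
  non-exceptional \<open>(k-2)\<close>-face \<open>T\<close> is, up to \<open>O(n)\<close> entries (norm \<open>O(\<surd>n)\<close> by Frobenius), half of
  all-ones plus a matrix that is diagonally equivalent to the character matrix \<open>\<chi>(e(T) * x u * x v)\<close>,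
  which has norm \<open>O(\<surd>n)\<close>. The quadratic form of \<open>A\<close> is the sum of the link forms, and
  orthogonality to coboundaries says exactly that each localised cochain is orthogonal to the
  degrees of its link; this kills the all-ones part and bounds the form by \<open>O(\<surd>n)\<close>, while all
  degrees are at least \<open>n / 8\<close>.

  Finally \<open>\<chi>(x\<^sub>1 \<cdots> x\<^sub>k)\<close> is almost uncorrelated with products of functions each ignoring one
  variable, by repeated Cauchy--Schwarz; the coboundary of any \<open>g\<close> is such a product.
\<close>

section \<open>Binary fields and their additive characters\<close>

text \<open>The fixed points are the roots of \<open>X^q - X\<close>, which splits into linear
  factors. Its derivative is the constant -1, because \<open>q = 0\<close> in the field, so all
  \<open>q\<close> roots are distinct.\<close>

lemma card_fixed_points_frobenius:
  fixes m :: nat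
  assumes char: "prime CHAR('a::alg_closed_field)" and m: "m \<ge> 1"
  shows "card {x::'a. x ^ (CHAR('a) ^ m) = x} = CHAR('a) ^ m"
proof -
  define q where "q = CHAR('a) ^ m"
  have "CHAR('a) \<ge> 2"
    using char prime_ge_2_nat by blast
  then have q2: "q \<ge> 2"
    unfolding q_def using m self_le_power[of "CHAR('a)" m] by linarith
  have q0: "of_nat q = (0::'a)"
    unfolding q_def using m by (simp add: of_nat_power)
  define p :: "'a poly" where "p = monom 1 q + [:0, -1:]"
  have "degree p = q"
    unfolding p_def using q2 by (subst degree_add_eq_left) (auto simp: degree_monom_eq)
  then have "p \<noteq> 0"
    using q2 by auto
  have root: "poly p x = 0 \<longleftrightarrow> x ^ q = x" for x
    by (simp add: p_def poly_monom)
  have pd: "pderiv p = [:-1:]"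
    by (simp add: p_def pderiv_add pderiv_monom pderiv_pCons q0)
  obtain A where A: "size A = q" "p = smult (lead_coeff p) (\<Prod>x\<in>#A. [:-x, 1:])"
    using alg_closed_imp_factorization[OF \<open>p \<noteq> 0\<close>] \<open>degree p = q\<close> by auto
  \<comment> \<open>A repeated root would also be a root of the derivative.\<close>
  have le1: "count A x \<le> 1" for x
  proof (rule ccontr)
    assume "\<not> ?thesis"
    then have "{#x, x#} \<subseteq># A"
      by (auto simp: subseteq_mset_def)
    then obtain A' where A': "A = add_mset x (add_mset x A')"
      by (metis mset_subset_eqD subset_mset.add_diff_inverse union_mset_add_mset_left
          empty_neutral(1) add_mset_add_single)
    define s where "s = smult (lead_coeff p) (\<Prod>x\<in>#A'. [:-x, 1:])"
    have "p = [:-x, 1:] * ([:-x, 1:] * s)"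
      using A(2) unfolding A' s_def by (simp add: mult_ac)
    then have "poly (pderiv p) x = 0"
      by (simp only: pderiv_mult poly_add poly_mult) simp
    with pd show False
      by simp
  qed
  have "lead_coeff p \<noteq> 0"
    using \<open>p \<noteq> 0\<close> by simp
  then have "poly p x = 0 \<longleftrightarrow> x \<in># A" for x
    by (subst A(2)) (auto simp: poly_prod_mset prod_mset_zero_iff)
  then have "set_mset A = {x. x ^ q = x}"
    using root by auto
  moreover have "card (set_mset A) = size A"
  proof -
    have "size A = (\<Sum>x\<in>set_mset A. count A x)"
      by (rule size_multiset_overloaded_eq)
    also have "\<dots> = (\<Sum>x\<in>set_mset A. 1)"
    proof (rule sum.cong)
      fix x assume "x \<in> set_mset A"
      then show "count A x = 1"
        using le1[of x] by (simp add: le_antisym Suc_leI)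
    qed simp
    finally show ?thesis
      by simp
  qed
  ultimately show ?thesis
    using A(1) q_def by simp
qed

text \<open>The finite field is a set inside a fixed field type, since its size has to grow with the
  number of vertices. The axiom \<open>chi_sum\<close> says that every twist of
  \<open>\<chi>\<close> by a nonzero \<open>c\<close> is still a nontrivial character; all
  cancellation below comes from it.\<close>

locale binary_field_character =
  fixes K :: "'f::field set" and \<chi> :: "'f \<Rightarrow> real"
  assumes finite_K: "finite K" and zero_K: "0 \<in> K" and one_K: "1 \<in> K"
    and add_K: "s \<in> K \<Longrightarrow> t \<in> K \<Longrightarrow> s + t \<in> K"
    and mult_K: "s \<in> K \<Longrightarrow> t \<in> K \<Longrightarrow> s * t \<in> K"
    and char_2: "(t::'f) + t = 0"
    and chi_pm: "\<chi> t = 1 \<or> \<chi> t = -1"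
    and chi_add: "s \<in> K \<Longrightarrow> t \<in> K \<Longrightarrow> \<chi> (s + t) = \<chi> s * \<chi> t"
    and chi_sum: "c \<in> K \<Longrightarrow> c \<noteq> 0 \<Longrightarrow> (\<Sum>t\<in>K. \<chi> (c * t)) = 0"

text \<open>\<open>K\<close> is the fixed field of a Frobenius power in the algebraic closure of the
  field with two elements, and \<open>\<chi>\<close> is the sign of the absolute trace
  \<open>Tr\<close>.\<close>

lemma binary_field_character_exists:
  assumes m: "m \<ge> 1"
  obtains K :: "bit alg_closure set" and \<chi>
    where "binary_field_character K \<chi>" "card K = 2 ^ m"
proof -
  have [simp]: "CHAR(bit) = 2"
    by (rule CHAR_eqI) (auto simp: even_of_nat_iff [where 'a = bit, symmetric] simp del: even_of_nat_iff)
  have CH: "CHAR(bit alg_closure) = 2"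
    by simp
  define K where "K = {x::bit alg_closure. x ^ (2 ^ m) = x}"
  have cardK: "card K = 2 ^ m"
    unfolding K_def using card_fixed_points_frobenius[where 'a="bit alg_closure", OF _ m] CH by simp
  then have finK: "finite K"
    by (metis card.infinite power_not_zero zero_neq_numeral)
  have two: "(2::bit alg_closure) = 0"
    using of_nat_CHAR[where 'a="bit alg_closure"] unfolding CH by simp
  have char2: "t + t = 0" for t :: "bit alg_closure"
    using two by (metis mult_2 mult_zero_left)
  have frob: "(s + t) ^ (2 ^ i) = s ^ (2 ^ i) + t ^ (2 ^ i)" for s t :: "bit alg_closure" and i
    by (rule freshmans_dream') (use CH in auto)
  define Tr where "Tr = (\<lambda>x::bit alg_closure. \<Sum>i<m. x ^ (2 ^ i))"
  have Tr_add: "Tr (s + t) = Tr s + Tr t" for s t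
    unfolding Tr_def frob by (rule sum.distrib)
  \<comment> \<open>Squaring permutes the summands of the trace cyclically, so the trace is its own
    square.\<close>
  have Tr_01: "Tr t = 0 \<or> Tr t = 1" if "t \<in> K" for t
  proof -
    have "Tr t ^ 2 = (\<Sum>i<m. (t ^ (2 ^ i)) ^ 2)"
      unfolding Tr_def by (rule freshmans_dream_sum) (use CH in auto)
    also have "\<dots> = (\<Sum>i<m. t ^ (2 ^ Suc i))"
      by (simp add: power_mult [symmetric] mult.commute)
    also have "\<dots> = (\<Sum>i<Suc m. t ^ (2 ^ i)) - t"
      by (subst sum.lessThan_Suc_shift) simp
    also have "\<dots> = Tr t"
      using that by (simp add: Tr_def K_def)
    finally have "Tr t * (Tr t - 1) = 0"
      by (simp add: power2_eq_square algebra_simps)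
    then show ?thesis
      by auto
  qed
  define \<chi> where "\<chi> = (\<lambda>t. if Tr t = 0 then 1 else - 1 :: real)"
  have mulK: "s * t \<in> K" if "s \<in> K" "t \<in> K" for s t
    using that by (simp add: K_def power_mult_distrib)
  have addK: "s + t \<in> K" if "s \<in> K" "t \<in> K" for s t
    using that by (simp add: K_def frob)
  have chi_add: "\<chi> (s + t) = \<chi> s * \<chi> t" if "s \<in> K" "t \<in> K" for s t
    using Tr_01[OF that(1)] Tr_01[OF that(2)] char2[of 1] by (auto simp: \<chi>_def Tr_add)
  \<comment> \<open>The trace is a nonzero polynomial, with coefficient 1 at degree 1, and its
    degree is smaller than the size of \<open>K\<close>; it cannot vanish on all of
    \<open>K\<close>.\<close>
  have "\<exists>t0\<in>K. Tr t0 \<noteq> 0"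
  proof (rule ccontr)
    assume "\<not> ?thesis"
    then have all0: "\<forall>t\<in>K. Tr t = 0"
      by blast
    define p :: "bit alg_closure poly" where "p = (\<Sum>i<m. monom 1 (2 ^ i))"
    have "coeff p 1 = (\<Sum>i<m. if i = 0 then 1 else 0)"
      unfolding p_def coeff_sum by (rule sum.cong) (auto simp: coeff_monom)
    also have "\<dots> = 1"
      using m by (subst sum.delta) auto
    finally have "p \<noteq> 0"
      by auto
    have "degree p \<le> 2 ^ (m - 1)"
      unfolding p_def
    proof (rule degree_sum_le)
      show "degree (monom 1 (2 ^ i) :: bit alg_closure poly) \<le> 2 ^ (m - 1)" if "i \<in> {..<m}" for i
        using that by (auto intro!: order_trans[OF degree_monom_le] power_increasing)
    qed auto
    moreover have "poly p t = Tr t" for t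
      by (simp add: p_def poly_sum poly_monom Tr_def)
    then have "K \<subseteq> {t. poly p t = 0}"
      using all0 by auto
    then have "card K \<le> degree p"
      using card_mono[OF poly_roots_finite[OF \<open>p \<noteq> 0\<close>]] card_poly_roots_bound[OF \<open>p \<noteq> 0\<close>]
      by (meson order_trans)
    ultimately have "(2::nat) ^ m \<le> 2 ^ (m - 1)"
      using cardK by linarith
    then have "m \<le> m - 1"
      by (rule power_le_imp_le_exp[rotated]) simp
    with m show False
      by simp
  qed
  then obtain t0 where t0: "t0 \<in> K" "Tr t0 \<noteq> 0"
    by blast
  have chi_sum: "(\<Sum>t\<in>K. \<chi> (c * t)) = 0" if c: "c \<in> K" "c \<noteq> 0" for c
  proof -
    have inv: "inverse c \<in> K"
      using c by (simp add: K_def power_inverse)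
    \<comment> \<open>Translating the summation variable by \<open>d\<close> multiplies every term
      by \<open>\<chi> t0 = -1\<close>, so the sum equals its own negative.\<close>
    define d where "d = inverse c * t0"
    have d: "d \<in> K" "c * d = t0"
      using inv t0 c mulK by (auto simp: d_def)
    have "(\<Sum>t\<in>K. \<chi> (c * t)) = (\<Sum>t\<in>K. \<chi> (c * (t + d)))"
      by (rule sum.reindex_bij_witness[where i="\<lambda>t. t + d" and j="\<lambda>t. t + d"])
        (auto simp: addK d add.assoc char2)
    also have "\<dots> = (\<Sum>t\<in>K. - \<chi> (c * t))"
    proof (rule sum.cong)
      fix t assume "t \<in> K"
      then have "\<chi> (c * (t + d)) = \<chi> (c * t) * \<chi> t0"
        using chi_add mulK c d by (simp add: distrib_left t0)
      then show "\<chi> (c * (t + d)) = - \<chi> (c * t)"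
        using t0 by (simp add: \<chi>_def)
    qed simp
    finally show ?thesis
      by (simp add: sum_negf)
  qed
  have "binary_field_character K \<chi>"
    by standard (use finK addK mulK char2 chi_add chi_sum in \<open>auto simp: \<chi>_def K_def\<close>)
  then show thesis
    using that cardK by blast
qed

section \<open>Bounded bilinear forms\<close>

lemma Cauchy_Schwarz_sum:
  fixes f g :: "'a \<Rightarrow> real"
  shows "\<bar>\<Sum>i\<in>A. f i * g i\<bar> \<le> sqrt (\<Sum>i\<in>A. (f i)\<^sup>2) * sqrt (\<Sum>i\<in>A. (g i)\<^sup>2)"
  using real_sqrt_le_mono[OF Cauchy_Schwarz_ineq_sum[of f g A]] by (simp add: real_sqrt_mult)

text \<open>This is the bound \<open>e\<close> on the Euclidean operator norm of the matrix
  \<open>E\<close>, stated through its bilinear form so that only finite sums occur.\<close>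

definition form_bound :: "'a set \<Rightarrow> ('a \<Rightarrow> 'a \<Rightarrow> real) \<Rightarrow> real \<Rightarrow> bool" where
  "form_bound U E e \<longleftrightarrow> (\<forall>f g. \<bar>\<Sum>u\<in>U. \<Sum>v\<in>U. E u v * f u * g v\<bar>
      \<le> e * sqrt (\<Sum>u\<in>U. (f u)\<^sup>2) * sqrt (\<Sum>v\<in>U. (g v)\<^sup>2))"

lemma form_boundD:
  "form_bound U E e \<Longrightarrow> \<bar>\<Sum>u\<in>U. \<Sum>v\<in>U. E u v * f u * g v\<bar>
      \<le> e * sqrt (\<Sum>u\<in>U. (f u)\<^sup>2) * sqrt (\<Sum>v\<in>U. (g v)\<^sup>2)"
  by (simp add: form_bound_def)

lemma form_bound_mono:
  assumes "form_bound U E e" "e \<le> e'"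
  shows "form_bound U E e'"
  unfolding form_bound_def
proof (intro allI)
  fix f g
  show "\<bar>\<Sum>u\<in>U. \<Sum>v\<in>U. E u v * f u * g v\<bar>
      \<le> e' * sqrt (\<Sum>u\<in>U. (f u)\<^sup>2) * sqrt (\<Sum>v\<in>U. (g v)\<^sup>2)"
    by (rule order_trans[OF form_boundD[OF assms(1)]])
      (intro mult_right_mono assms(2) real_sqrt_ge_zero sum_nonneg, auto)
qed

lemma form_bound_add:
  assumes "form_bound U E e" "form_bound U E' e'"
  shows "form_bound U (\<lambda>u v. E u v + E' u v) (e + e')"
  unfolding form_bound_def
proof (intro allI)
  fix f g
  have "(\<Sum>u\<in>U. \<Sum>v\<in>U. (E u v + E' u v) * f u * g v)
      = (\<Sum>u\<in>U. \<Sum>v\<in>U. E u v * f u * g v) + (\<Sum>u\<in>U. \<Sum>v\<in>U. E' u v * f u * g v)"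
    by (simp add: distrib_right sum.distrib)
  then show "\<bar>\<Sum>u\<in>U. \<Sum>v\<in>U. (E u v + E' u v) * f u * g v\<bar>
      \<le> (e + e') * sqrt (\<Sum>u\<in>U. (f u)\<^sup>2) * sqrt (\<Sum>v\<in>U. (g v)\<^sup>2)"
    using form_boundD[OF assms(1), of f g] form_boundD[OF assms(2), of f g]
    by (simp add: distrib_right)
qed

lemma form_bound_scale:
  assumes "form_bound U E e"
  shows "form_bound U (\<lambda>u v. c * E u v) (\<bar>c\<bar> * e)"
  unfolding form_bound_def
proof (intro allI)
  fix f g
  have "(\<Sum>u\<in>U. \<Sum>v\<in>U. c * E u v * f u * g v) = c * (\<Sum>u\<in>U. \<Sum>v\<in>U. E u v * f u * g v)"
    by (simp add: sum_distrib_left mult.assoc)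
  then show "\<bar>\<Sum>u\<in>U. \<Sum>v\<in>U. c * E u v * f u * g v\<bar>
      \<le> \<bar>c\<bar> * e * sqrt (\<Sum>u\<in>U. (f u)\<^sup>2) * sqrt (\<Sum>v\<in>U. (g v)\<^sup>2)"
    using form_boundD[OF assms, of f g] by (simp add: abs_mult mult.assoc mult_left_mono)
qed

text \<open>Conjugation by a diagonal sign matrix is an isometry: the signs are absorbed into
  \<open>f\<close> and \<open>g\<close>.\<close>

lemma form_bound_signs:
  assumes "form_bound U E e" "\<And>u. u \<in> U \<Longrightarrow> (p u)\<^sup>2 = 1"
  shows "form_bound U (\<lambda>u v. p u * p v * E u v) e"
  unfolding form_bound_def
proof (intro allI)
  fix f g
  show "\<bar>\<Sum>u\<in>U. \<Sum>v\<in>U. p u * p v * E u v * f u * g v\<bar>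
      \<le> e * sqrt (\<Sum>u\<in>U. (f u)\<^sup>2) * sqrt (\<Sum>v\<in>U. (g v)\<^sup>2)"
    using form_boundD[OF assms(1), of "\<lambda>u. p u * f u" "\<lambda>u. p u * g u"] assms(2)
    by (simp add: power_mult_distrib mult_ac)
qed

text \<open>The operator norm is at most the Frobenius norm, whose square is here at most the number
  of positions in the support \<open>Z\<close>.\<close>

lemma form_bound_Frobenius:
  assumes "finite U" and Z: "Z \<subseteq> U \<times> U" "real (card Z) \<le> z"
    and le1: "\<And>u v. u \<in> U \<Longrightarrow> v \<in> U \<Longrightarrow> \<bar>P u v\<bar> \<le> 1"
    and supp: "\<And>u v. u \<in> U \<Longrightarrow> v \<in> U \<Longrightarrow> (u, v) \<notin> Z \<Longrightarrow> P u v = 0"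
  shows "form_bound U P (sqrt z)"
  unfolding form_bound_def
proof (intro allI)
  fix f g
  have fZ: "finite Z"
    using Z(1) assms(1) finite_subset by blast
  have "(\<Sum>u\<in>U. \<Sum>v\<in>U. P u v * f u * g v) = (\<Sum>p\<in>U\<times>U. P (fst p) (snd p) * (f (fst p) * g (snd p)))"
    by (simp add: sum.cartesian_product case_prod_beta mult.assoc)
  then have "\<bar>\<Sum>u\<in>U. \<Sum>v\<in>U. P u v * f u * g v\<bar>
      \<le> sqrt (\<Sum>p\<in>U\<times>U. (P (fst p) (snd p))\<^sup>2) * sqrt (\<Sum>p\<in>U\<times>U. (f (fst p) * g (snd p))\<^sup>2)"
    using Cauchy_Schwarz_sum[of "\<lambda>p. P (fst p) (snd p)" "\<lambda>p. f (fst p) * g (snd p)" "U\<times>U"] by simp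
  also have "(\<Sum>p\<in>U\<times>U. (f (fst p) * g (snd p))\<^sup>2) = (\<Sum>u\<in>U. (f u)\<^sup>2) * (\<Sum>v\<in>U. (g v)\<^sup>2)"
    by (simp add: sum_product sum.cartesian_product case_prod_beta power_mult_distrib)
  also have "sqrt (\<Sum>p\<in>U\<times>U. (P (fst p) (snd p))\<^sup>2) \<le> sqrt z"
  proof -
    have "(\<Sum>p\<in>U\<times>U. (P (fst p) (snd p))\<^sup>2) = (\<Sum>p\<in>Z. (P (fst p) (snd p))\<^sup>2)"
      by (rule sum.mono_neutral_right) (use assms(1) Z(1) supp in auto)
    also have "\<dots> \<le> (\<Sum>p\<in>Z. 1)"
      by (rule sum_mono) (use Z(1) le1 in \<open>auto simp: abs_square_le_1\<close>)
    finally show ?thesis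
      using Z(2) by simp
  qed
  finally show "\<bar>\<Sum>u\<in>U. \<Sum>v\<in>U. P u v * f u * g v\<bar>
      \<le> sqrt z * sqrt (\<Sum>u\<in>U. (f u)\<^sup>2) * sqrt (\<Sum>v\<in>U. (g v)\<^sup>2)"
    by (simp add: real_sqrt_mult mult.assoc mult_right_mono sum_nonneg)
qed

text \<open>Orthogonality to the row sums expresses \<open>\<alpha> * m * s\<close>, with
  \<open>s\<close> the sum of \<open>f\<close> and \<open>m\<close> the size of \<open>U\<close>,
  through the error form evaluated at \<open>f\<close> and the constant 1. Hence \<open>s\<close> is
  small, and the all-ones part contributes only \<open>\<alpha> * s^2\<close> to the quadratic
  form.\<close>

lemma quadratic_form_orthogonal_to_row_sums:
  fixes f :: "'a \<Rightarrow> real"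
  assumes E: "form_bound U E e" "e \<ge> 0" and \<alpha>: "\<alpha> > 0" and U: "finite U" "U \<noteq> {}"
    and M: "\<And>u v. u \<in> U \<Longrightarrow> v \<in> U \<Longrightarrow> M u v = \<alpha> + E u v"
    and orth: "(\<Sum>u\<in>U. (\<Sum>v\<in>U. M u v) * f u) = 0"
  shows "\<bar>\<Sum>u\<in>U. \<Sum>v\<in>U. M u v * f u * f v\<bar> \<le> (e\<^sup>2 / (\<alpha> * real (card U)) + e) * (\<Sum>u\<in>U. (f u)\<^sup>2)"
proof -
  define m where "m = real (card U)"
  define s where "s = (\<Sum>u\<in>U. f u)"
  define q where "q = (\<Sum>u\<in>U. (f u)\<^sup>2)"
  have m: "m > 0"
    unfolding m_def using U by (simp add: card_gt_0_iff)
  have q: "q \<ge> 0"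
    unfolding q_def by (intro sum_nonneg) auto
  have "(\<Sum>u\<in>U. (\<Sum>v\<in>U. M u v) * f u) = (\<Sum>u\<in>U. \<Sum>v\<in>U. \<alpha> * f u + E u v * f u * 1)"
    using M by (simp add: sum_distrib_right distrib_right)
  also have "\<dots> = \<alpha> * m * s + (\<Sum>u\<in>U. \<Sum>v\<in>U. E u v * f u * 1)"
    by (simp add: sum.distrib m_def s_def sum_distrib_left sum_distrib_right mult_ac)
  finally have "\<alpha> * m * s = - (\<Sum>u\<in>U. \<Sum>v\<in>U. E u v * f u * 1)"
    using orth by simp
  then have "\<alpha> * m * \<bar>s\<bar> = \<bar>\<Sum>u\<in>U. \<Sum>v\<in>U. E u v * f u * 1\<bar>"
    using m \<alpha> by (auto simp: abs_mult dest: arg_cong[where f = abs])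
  also have "\<dots> \<le> e * sqrt q * sqrt m"
    using form_boundD[OF E(1), of f "\<lambda>_. 1"] by (simp add: q_def m_def)
  finally have "(\<alpha> * m * \<bar>s\<bar>)\<^sup>2 \<le> (e * sqrt q * sqrt m)\<^sup>2"
    using m \<alpha> by (intro power_mono) auto
  then have "\<alpha>\<^sup>2 * m\<^sup>2 * s\<^sup>2 \<le> e\<^sup>2 * q * m"
    using m q by (simp add: power_mult_distrib)
  then have "(\<alpha> * m) * (\<alpha> * m * s\<^sup>2) \<le> m * (e\<^sup>2 * q)"
    by (simp add: power2_eq_square mult_ac)
  then have "\<alpha> * (\<alpha> * m * s\<^sup>2) \<le> e\<^sup>2 * q"
    using m by (simp add: mult.assoc mult.left_commute[of \<alpha> m])
  then have s2: "\<alpha> * s\<^sup>2 \<le> e\<^sup>2 / (\<alpha> * m) * q"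
    using m \<alpha> by (simp add: field_simps)
  have "(\<Sum>u\<in>U. \<Sum>v\<in>U. M u v * f u * f v)
      = (\<Sum>u\<in>U. \<Sum>v\<in>U. \<alpha> * (f u * f v) + E u v * f u * f v)"
    using M by (simp add: distrib_right mult.assoc)
  also have "\<dots> = \<alpha> * (\<Sum>u\<in>U. \<Sum>v\<in>U. f u * f v) + (\<Sum>u\<in>U. \<Sum>v\<in>U. E u v * f u * f v)"
    by (simp add: sum.distrib sum_distrib_left)
  also have "(\<Sum>u\<in>U. \<Sum>v\<in>U. f u * f v) = s\<^sup>2"
    by (simp add: s_def power2_eq_square sum_product)
  finally have "\<bar>\<Sum>u\<in>U. \<Sum>v\<in>U. M u v * f u * f v\<bar>
      \<le> \<alpha> * s\<^sup>2 + \<bar>\<Sum>u\<in>U. \<Sum>v\<in>U. E u v * f u * f v\<bar>"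
    using \<alpha> by (simp add: abs_triangle_ineq[THEN order_trans] abs_mult)
  moreover have "\<bar>\<Sum>u\<in>U. \<Sum>v\<in>U. E u v * f u * f v\<bar> \<le> e * q"
    using form_boundD[OF E(1), of f f] q by (simp add: q_def mult.assoc)
  ultimately show ?thesis
    using s2 unfolding q_def[symmetric] m_def[symmetric] by (simp add: distrib_right)
qed

section \<open>Exceptional sets and character forms\<close>

text \<open>The summand 1 counts the vertex 0; each of at most \<open>2 ^ k\<close> subsets of a set
  of size at most \<open>k\<close> accounts for at most \<open>B\<close> further vertices.\<close>

definition exc_const :: "nat \<Rightarrow> nat \<Rightarrow> nat" where
  "exc_const k B = 1 + 2 ^ k * B"

text \<open>Coefficient of \<surd>n in the norm of the error matrix of a link: half of the character
  matrix, plus the Frobenius bound for the exceptional and diagonal entries.\<close>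

definition form_const :: "nat \<Rightarrow> nat \<Rightarrow> real" where
  "form_const k B = real B / 2 + sqrt (2 * real (exc_const k B) + 1)"

definition link_const :: "nat \<Rightarrow> nat \<Rightarrow> real" where
  "link_const k B = 4 * (form_const k B)\<^sup>2 + form_const k B"

text \<open>The bound \<open>B\<close> on the fibres of the labelling moves sums from vertices to
  the field. The hypothesis \<open>equidistributed\<close> is only as strong as a linear lower bound
  on degrees requires.\<close>

locale character_complex = binary_field_character K \<chi>
  for K :: "'f::field set" and \<chi> :: "'f \<Rightarrow> real" +
  fixes k n B :: nat and x :: "nat \<Rightarrow> 'f"
  assumes k_ge_2: "k \<ge> 2" and n_ge: "n \<ge> 8 * k" and card_K: "card K \<le> n"
    and x_K: "x v \<in> K" and x_nonzero: "x v \<noteq> 0"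
    and fibre_le: "card {v. v < n \<and> x v = t} \<le> B"
    and equidistributed: "c \<in> K \<Longrightarrow> c \<noteq> 0 \<Longrightarrow> \<bar>\<Sum>v<n. \<chi> (c * x v)\<bar> \<le> real n / 2"
begin

definition xprod :: "nat set \<Rightarrow> 'f" where
  "xprod T = (\<Prod>v\<in>T. x v)"

text \<open>For nonempty \<open>T\<close>, the elementary symmetric polynomial of degree
  \<open>card T - 1\<close> in the labels. It is affine in each single label, which drives every
  later computation.\<close>

definition esym :: "nat set \<Rightarrow> 'f" where
  "esym T = (\<Sum>w\<in>T. xprod (T - {w}))"

text \<open>The condition \<open>T \<noteq> {}\<close> matters because the empty sum makes
  \<open>esym {} = 0\<close>. Quantifying over all subsets makes the notion monotone.\<close>

definition exceptional :: "nat set \<Rightarrow> bool" where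
  "exceptional F \<longleftrightarrow> 0 \<in> F \<or> (\<exists>T\<subseteq>F. T \<noteq> {} \<and> esym T = 0)"

definition exc_ext :: "nat set \<Rightarrow> nat set" where
  "exc_ext G = {v. v < n \<and> v \<notin> G \<and> (v = 0 \<or> (\<exists>S\<subseteq>G. esym (insert v S) = 0))}"

abbreviation r :: nat where
  "r \<equiv> exc_const k B"

section \<open>Arithmetic of the character and of the label polynomials\<close>

lemma chi_sq [simp]: "(\<chi> t)\<^sup>2 = 1"
  using chi_pm[of t] by auto

lemma chi_mult_self [simp]: "\<chi> t * \<chi> t = 1"
  using chi_pm[of t] by auto

lemma abs_chi [simp]: "\<bar>\<chi> t\<bar> = 1"
  using chi_pm[of t] by auto

lemma chi_0 [simp]: "\<chi> 0 = 1"
  using chi_add[OF zero_K zero_K] chi_pm[of 0] by auto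

lemma sum_K: "(\<And>i. i \<in> A \<Longrightarrow> f i \<in> K) \<Longrightarrow> sum f A \<in> K"
  by (induction A rule: infinite_finite_induct) (auto simp: zero_K add_K)

lemma chi_sum_eq_prod: "(\<And>i. i \<in> A \<Longrightarrow> f i \<in> K) \<Longrightarrow> \<chi> (sum f A) = (\<Prod>i\<in>A. \<chi> (f i))"
  by (induction A rule: infinite_finite_induct) (auto simp: chi_add sum_K)

lemma xprod_K: "xprod T \<in> K"
  unfolding xprod_def by (induction T rule: infinite_finite_induct) (auto simp: one_K mult_K x_K)

lemma xprod_nonzero: "xprod T \<noteq> 0"
  unfolding xprod_def by (induction T rule: infinite_finite_induct) (auto simp: x_nonzero)

lemma xprod_insert: "finite T \<Longrightarrow> v \<notin> T \<Longrightarrow> xprod (insert v T) = x v * xprod T"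
  by (simp add: xprod_def)

lemma esym_K: "esym T \<in> K"
  unfolding esym_def by (rule sum_K) (rule xprod_K)

lemma chi_esym: "\<chi> (esym T) = (\<Prod>w\<in>T. \<chi> (xprod (T - {w})))"
  unfolding esym_def by (rule chi_sum_eq_prod) (rule xprod_K)

lemma esym_insert:
  assumes "finite T" "v \<notin> T"
  shows "esym (insert v T) = xprod T + x v * esym T"
proof -
  have "esym (insert v T) = xprod T + (\<Sum>w\<in>T. xprod (insert v T - {w}))"
    using assms by (simp add: esym_def)
  also have "(\<Sum>w\<in>T. xprod (insert v T - {w})) = (\<Sum>w\<in>T. x v * xprod (T - {w}))"
  proof (rule sum.cong)
    fix w assume "w \<in> T"
    then have "insert v T - {w} = insert v (T - {w})"
      using assms by auto
    then show "xprod (insert v T - {w}) = x v * xprod (T - {w})"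
      using assms by (simp add: xprod_insert)
  qed simp
  finally show ?thesis
    by (simp add: esym_def sum_distrib_left)
qed

text \<open>Grouping the vertices by label loses a factor of at most \<open>B\<close> and makes
  character orthogonality over the field available.\<close>

lemma sum_fibre_le:
  assumes "U \<subseteq> {..<n}" "\<And>t. \<phi> t \<ge> (0::real)"
  shows "(\<Sum>u\<in>U. \<phi> (x u)) \<le> real B * (\<Sum>t\<in>K. \<phi> t)"
proof -
  have fin: "finite U"
    using assms(1) finite_subset by blast
  have "(\<Sum>u\<in>U. \<phi> (x u)) = (\<Sum>t\<in>K. \<Sum>u\<in>{u\<in>U. x u = t}. \<phi> (x u))"
    using fin finite_K x_K by (intro sum.group[symmetric]) auto
  also have "\<dots> = (\<Sum>t\<in>K. real (card {u\<in>U. x u = t}) * \<phi> t)"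
    by (rule sum.cong) auto
  also have "\<dots> \<le> (\<Sum>t\<in>K. real B * \<phi> t)"
  proof (intro sum_mono mult_right_mono assms(2))
    fix t
    have "card {u\<in>U. x u = t} \<le> card {v. v < n \<and> x v = t}"
      using assms(1) by (intro card_mono) auto
    then show "real (card {u\<in>U. x u = t}) \<le> real B"
      using fibre_le[of t] by simp
  qed
  finally show ?thesis
    by (simp add: sum_distrib_left)
qed

lemma add_eq_0_iff_eq: "(s::'f) + t = 0 \<longleftrightarrow> s = t"
  using char_2[of t] by (metis add_right_cancel)

text \<open>By orthogonality, the matrix \<open>\<chi> (c * t * x v)\<close> with rows
  \<open>t\<close> in \<open>K\<close> has squared norm at most \<open>B * card K\<close>. Replacing
  the rows by vertices costs another factor \<open>B\<close> in the square, and
  \<open>card K\<close> is at most \<open>n\<close>.\<close>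

lemma character_form_bound:
  assumes c: "c \<in> K" "c \<noteq> 0" and U: "U \<subseteq> {..<n}"
  shows "form_bound U (\<lambda>u v. \<chi> (c * x u * x v)) (real B * sqrt (real n))"
  unfolding form_bound_def
proof (intro allI)
  fix f g :: "nat \<Rightarrow> real"
  have fin: "finite U"
    using U finite_subset by blast
  define h where "h t = (\<Sum>v\<in>U. \<chi> (c * t * x v) * g v)" for t
  define q where "q = (\<Sum>v\<in>U. (g v)\<^sup>2)"
  have q0: "q \<ge> 0"
    unfolding q_def by (intro sum_nonneg) auto
  have orth: "(\<Sum>t\<in>K. \<chi> (c * t * x v) * \<chi> (c * t * x v')) = (if x v = x v' then real (card K) else 0)"
    for v v'
  proof (cases "x v = x v'")
    case False
    have "(\<Sum>t\<in>K. \<chi> (c * t * x v) * \<chi> (c * t * x v')) = (\<Sum>t\<in>K. \<chi> ((c * (x v + x v')) * t))"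
    proof (rule sum.cong)
      fix t assume "t \<in> K"
      then have "\<chi> (c * t * x v + c * t * x v') = \<chi> (c * t * x v) * \<chi> (c * t * x v')"
        using c x_K by (intro chi_add mult_K)
      then show "\<chi> (c * t * x v) * \<chi> (c * t * x v') = \<chi> ((c * (x v + x v')) * t)"
        by (simp add: algebra_simps)
    qed simp
    also have "\<dots> = 0"
      using c False x_K by (intro chi_sum) (auto simp: mult_K add_K add_eq_0_iff_eq)
    finally show ?thesis
      using False by simp
  qed simp
  have "(\<Sum>t\<in>K. (h t)\<^sup>2)
      = (\<Sum>t\<in>K. \<Sum>v\<in>U. \<Sum>v'\<in>U. (\<chi> (c * t * x v) * \<chi> (c * t * x v')) * (g v * g v'))"
    by (simp add: h_def power2_eq_square sum_product mult_ac)
  also have "\<dots> = (\<Sum>v\<in>U. \<Sum>v'\<in>U. \<Sum>t\<in>K. (\<chi> (c * t * x v) * \<chi> (c * t * x v')) * (g v * g v'))"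
    by (subst sum.swap, rule sum.cong[OF refl], rule sum.swap)
  also have "\<dots> = (\<Sum>v\<in>U. \<Sum>v'\<in>U. (if x v = x v' then real (card K) else 0) * (g v * g v'))"
    by (simp only: sum_distrib_right[symmetric] orth)
  \<comment> \<open>The inequality of means separates \<open>v\<close> from \<open>v'\<close>, so
    that it remains to count the at most \<open>B\<close> vertices sharing a given label.\<close>
  also have "\<dots> \<le> (\<Sum>v\<in>U. \<Sum>v'\<in>U. (if x v = x v' then real (card K) else 0) * (((g v)\<^sup>2 + (g v')\<^sup>2) / 2))"
  proof (intro sum_mono mult_left_mono)
    fix v v'
    show "g v * g v' \<le> ((g v)\<^sup>2 + (g v')\<^sup>2) / 2"
      using sum_squares_bound[of "g v" "g v'"] by simp
  qed auto
  also have "\<dots> = (\<Sum>v\<in>U. \<Sum>v'\<in>U. (if x v = x v' then real (card K) else 0) * (g v)\<^sup>2 / 2)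
      + (\<Sum>v\<in>U. \<Sum>v'\<in>U. (if x v = x v' then real (card K) else 0) * (g v')\<^sup>2 / 2)"
    by (simp add: add_divide_distrib distrib_left sum.distrib)
  also have "(\<Sum>v\<in>U. \<Sum>v'\<in>U. (if x v = x v' then real (card K) else 0) * (g v')\<^sup>2 / 2)
      = (\<Sum>v\<in>U. \<Sum>v'\<in>U. (if x v = x v' then real (card K) else 0) * (g v)\<^sup>2 / 2)"
    by (subst sum.swap) (auto intro!: sum.cong)
  also have "(\<Sum>v\<in>U. \<Sum>v'\<in>U. (if x v = x v' then real (card K) else 0) * (g v)\<^sup>2 / 2)
     = (\<Sum>v\<in>U. (g v)\<^sup>2 / 2 * (\<Sum>v'\<in>U. if x v = x v' then real (card K) else 0))"
    by (simp add: sum_distrib_left mult_ac)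
  also have "\<dots> \<le> (\<Sum>v\<in>U. (g v)\<^sup>2 / 2 * (real B * real (card K)))"
  proof (intro sum_mono mult_left_mono)
    fix v
    have "(\<Sum>v'\<in>U. if x v = x v' then real (card K) else 0)
        \<le> real B * (\<Sum>t\<in>K. if x v = t then real (card K) else 0)"
      by (rule sum_fibre_le[OF U, where \<phi> = "\<lambda>t. if x v = t then real (card K) else 0"]) simp
    also have "\<dots> = real B * real (card K)"
      using finite_K x_K by simp
    finally show "(\<Sum>v'\<in>U. if x v = x v' then real (card K) else 0) \<le> real B * real (card K)" .
  qed auto
  also have "(\<Sum>v\<in>U. (g v)\<^sup>2 / 2 * (real B * real (card K))) = real B * real (card K) / 2 * q"
    by (simp add: q_def sum_distrib_left mult_ac)
  finally have "(\<Sum>t\<in>K. (h t)\<^sup>2) \<le> real B * real (card K) * q"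
    by (simp add: mult_ac)
  also have "\<dots> \<le> real B * real n * q"
    using card_K q0 by (intro mult_right_mono mult_left_mono) auto
  finally have h: "(\<Sum>t\<in>K. (h t)\<^sup>2) \<le> real B * real n * q" .
  have "(\<Sum>u\<in>U. (h (x u))\<^sup>2) \<le> real B * (\<Sum>t\<in>K. (h t)\<^sup>2)"
    by (rule sum_fibre_le[OF U]) simp
  also have "\<dots> \<le> real B * (real B * real n * q)"
    by (intro mult_left_mono h) auto
  finally have hx: "sqrt (\<Sum>u\<in>U. (h (x u))\<^sup>2) \<le> sqrt (real B * (real B * real n * q))"
    by simp
  have "(\<Sum>u\<in>U. \<Sum>v\<in>U. \<chi> (c * x u * x v) * f u * g v) = (\<Sum>u\<in>U. f u * h (x u))"
    by (simp add: h_def sum_distrib_left mult_ac)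
  also have "\<bar>\<dots>\<bar> \<le> sqrt (\<Sum>u\<in>U. (f u)\<^sup>2) * sqrt (\<Sum>u\<in>U. (h (x u))\<^sup>2)"
    by (rule Cauchy_Schwarz_sum)
  also have "\<dots> \<le> sqrt (\<Sum>u\<in>U. (f u)\<^sup>2) * sqrt (real B * (real B * real n * q))"
    by (intro mult_left_mono hx real_sqrt_ge_zero sum_nonneg) auto
  also have "\<dots> = real B * sqrt (real n) * sqrt (\<Sum>u\<in>U. (f u)\<^sup>2) * sqrt q"
    by (simp add: real_sqrt_mult mult_ac)
  finally show "\<bar>\<Sum>u\<in>U. \<Sum>v\<in>U. \<chi> (c * x u * x v) * f u * g v\<bar>
      \<le> real B * sqrt (real n) * sqrt (\<Sum>u\<in>U. (f u)\<^sup>2) * sqrt (\<Sum>v\<in>U. (g v)\<^sup>2)"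
    by (simp add: q_def)
qed

section \<open>Vertices whose addition makes a set exceptional\<close>

lemma exceptional_mono: "exceptional F \<Longrightarrow> F \<subseteq> G \<Longrightarrow> exceptional G"
  unfolding exceptional_def by blast

lemma exceptional_insert:
  assumes "v < n" "v \<notin> G"
  shows "exceptional (insert v G) \<longleftrightarrow> exceptional G \<or> v \<in> exc_ext G"
proof
  assume "exceptional (insert v G)"
  then consider "v = 0" | "0 \<in> G" | T where "T \<subseteq> insert v G" "T \<noteq> {}" "esym T = 0"
    unfolding exceptional_def by auto
  then show "exceptional G \<or> v \<in> exc_ext G"
  proof cases
    case 3
    show ?thesis
    proof (cases "v \<in> T")
      case True
      then have "T - {v} \<subseteq> G" "esym (insert v (T - {v})) = 0"
        using 3 by (auto simp: insert_absorb)
      then show ?thesis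
        using assms unfolding exc_ext_def by blast
    next
      case False
      then show ?thesis
        using 3 unfolding exceptional_def by blast
    qed
  qed (use assms in \<open>auto simp: exceptional_def exc_ext_def\<close>)
next
  assume "exceptional G \<or> v \<in> exc_ext G"
  then show "exceptional (insert v G)"
  proof
    assume "v \<in> exc_ext G"
    then consider "v = 0" | S where "S \<subseteq> G" "esym (insert v S) = 0"
      unfolding exc_ext_def by auto
    then show ?thesis
    proof cases
      case 2
      then show ?thesis
        unfolding exceptional_def by (metis insert_mono insert_not_empty)
    qed (auto simp: exceptional_def)
  qed (auto intro: exceptional_mono)
qed

text \<open>For a fixed \<open>S\<close>, the equation \<open>esym (insert v S) = 0\<close> is
  linear in \<open>x v\<close>, so it determines the label of \<open>v\<close> and leaves at most
  \<open>B\<close> choices.\<close>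

lemma card_exc_ext_le:
  assumes "finite G" "card G \<le> k"
  shows "card (exc_ext G) \<le> r"
proof -
  define W where "W S = {v. v < n \<and> v \<notin> G \<and> esym (insert v S) = 0}" for S
  have W: "card (W S) \<le> B" if "S \<subseteq> G" for S
  proof -
    have "finite S"
      using that assms(1) finite_subset by blast
    have eq: "x v = - xprod S / esym S" if "v \<in> W S" for v
    proof -
      have "v \<notin> S"
        using that \<open>S \<subseteq> G\<close> by (auto simp: W_def)
      then have e: "xprod S + x v * esym S = 0"
        using that esym_insert[OF \<open>finite S\<close>] by (simp add: W_def)
      \<comment> \<open>Otherwise the equation would force the product of nonzero labels to
        vanish.\<close>
      then have "esym S \<noteq> 0"
        using xprod_nonzero[of S] by auto
      then show ?thesis
        using e by (simp add: field_simps eq_neg_iff_add_eq_0)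
    qed
    have "W S \<subseteq> {v. v < n \<and> x v = - xprod S / esym S}"
      using eq by (auto simp: W_def)
    then have "card (W S) \<le> card {v. v < n \<and> x v = - xprod S / esym S}"
      by (intro card_mono) auto
    then show ?thesis
      using fibre_le order_trans by blast
  qed
  have fW: "finite (W S)" for S
    by (simp add: W_def)
  have "exc_ext G \<subseteq> {0} \<union> (\<Union>S\<in>Pow G. W S)"
    by (auto simp: exc_ext_def W_def)
  then have "card (exc_ext G) \<le> card ({0} \<union> (\<Union>S\<in>Pow G. W S))"
    using assms(1) fW by (intro card_mono) auto
  also have "\<dots> \<le> 1 + card (\<Union>S\<in>Pow G. W S)"
    using card_Un_le[of "{0}" "\<Union>S\<in>Pow G. W S"] by simp
  also have "card (\<Union>S\<in>Pow G. W S) \<le> (\<Sum>S\<in>Pow G. card (W S))"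
    using assms(1) by (intro card_UN_le) auto
  also have "\<dots> \<le> (\<Sum>S\<in>Pow G. B)"
    by (intro sum_mono W) auto
  also have "\<dots> = 2 ^ card G * B"
    using assms(1) by (simp add: card_Pow)
  also have "\<dots> \<le> 2 ^ k * B"
    using assms(2) by (intro mult_right_mono power_increasing) auto
  finally show ?thesis
    by (simp add: exc_const_def)
qed

lemma finite_exc_ext [simp]: "finite (exc_ext G)"
  by (simp add: exc_ext_def)

end

section \<open>Incidence, cones and coboundaries\<close>

lemma finite_cfaces: "\<Delta> \<subseteq> Pow {..<n} \<Longrightarrow> finite (cfaces \<Delta> m)"
  unfolding cfaces_def by (rule finite_subset[of _ "Pow {..<n}"]) auto

text \<open>A coface of \<open>F\<close> is \<open>F\<close> plus exactly one new vertex. This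
  converts boundaries, degrees and coboundary pairings into sums over vertices.\<close>

lemma sum_cofaces:
  fixes \<phi> :: "nat set \<Rightarrow> 'a::comm_monoid_add"
  assumes \<Delta>: "\<Delta> \<subseteq> Pow {..<n}" and F: "F \<subseteq> {..<n}" "card F = m"
    and zero: "\<And>H. H \<in> cfaces \<Delta> (Suc m) \<Longrightarrow> \<not> F \<subseteq> H \<Longrightarrow> \<phi> H = 0"
  shows "(\<Sum>H\<in>cfaces \<Delta> (Suc m). \<phi> H) = (\<Sum>v\<in>{..<n} - F. if insert v F \<in> \<Delta> then \<phi> (insert v F) else 0)"
proof -
  have finF: "finite F"
    using F(1) finite_subset by blast
  define W where "W = {v \<in> {..<n} - F. insert v F \<in> \<Delta>}"
  have inj: "inj_on (\<lambda>v. insert v F) W"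
    by (rule inj_onI) (auto simp: W_def)
  have "(\<Sum>H\<in>cfaces \<Delta> (Suc m). \<phi> H) = (\<Sum>H\<in>(\<lambda>v. insert v F) ` W. \<phi> H)"
  proof (rule sum.mono_neutral_right)
    show "finite (cfaces \<Delta> (Suc m))"
      by (rule finite_cfaces[OF \<Delta>])
    show "(\<lambda>v. insert v F) ` W \<subseteq> cfaces \<Delta> (Suc m)"
      using finF F by (auto simp: W_def cfaces_def)
    show "\<forall>H\<in>cfaces \<Delta> (Suc m) - (\<lambda>v. insert v F) ` W. \<phi> H = 0"
    proof
      fix H assume H: "H \<in> cfaces \<Delta> (Suc m) - (\<lambda>v. insert v F) ` W"
      have "\<not> F \<subseteq> H"
      proof
        assume "F \<subseteq> H"
        have finH: "finite H"
          using H \<Delta> by (auto simp: cfaces_def intro: finite_subset)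
        have "card (H - F) = 1"
          using H F finF \<open>F \<subseteq> H\<close> by (simp add: card_Diff_subset cfaces_def)
        then obtain v where "H - F = {v}"
          by (auto simp: card_1_singleton_iff)
        then have "H = insert v F" "v \<in> H" "v \<notin> F"
          using \<open>F \<subseteq> H\<close> by auto
        then have "v \<in> W"
          using H \<Delta> by (auto simp: W_def cfaces_def)
        with H \<open>H = insert v F\<close> show False
          by auto
      qed
      then show "\<phi> H = 0"
        using zero H by blast
    qed
  qed
  also have "\<dots> = (\<Sum>v\<in>W. \<phi> (insert v F))"
    using inj by (simp add: sum.reindex)
  also have "\<dots> = (\<Sum>v\<in>{..<n} - F. if insert v F \<in> \<Delta> then \<phi> (insert v F) else 0)"
    unfolding W_def by (rule sum.inter_filter) simp
  finally show ?thesis .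
qed

section \<open>Incidence numbers and the cone construction\<close>

lemma inc_eq_0: "\<not> G \<subseteq> F \<Longrightarrow> inc F G = 0"
  by (simp add: inc_def)

lemma inc_insert:
  assumes "finite G" "v \<notin> G"
  shows "inc (insert v G) G = (-1) ^ card {y\<in>G. y < v}"
proof -
  have "insert v G - G = {v}"
    using assms by auto
  moreover have "{y \<in> insert v G. y < v} = {y\<in>G. y < v}"
    by auto
  ultimately show ?thesis
    using assms by (simp add: inc_def subset_insertI)
qed

lemma inc_sq: "finite G \<Longrightarrow> v \<notin> G \<Longrightarrow> (inc (insert v G) G :: real)\<^sup>2 = 1"
  by (simp add: inc_insert power_mult[symmetric] mult.commute[of _ 2])

text \<open>The cone over a cycle with apex 0 bounds it; since 0 is the least vertex, no signs occur.\<close>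
lemma reduced_hom_vanishes_cone:
  assumes \<Delta>: "\<Delta> \<subseteq> Pow {..<n}" and "n > 0"
    and skel: "\<And>F. F \<subseteq> {..<n} \<Longrightarrow> card F \<le> Suc i \<Longrightarrow> F \<in> \<Delta>"
    and cone: "\<And>F. F \<subseteq> {..<n} \<Longrightarrow> card F = Suc (Suc i) \<Longrightarrow> 0 \<in> F \<Longrightarrow> F \<in> \<Delta>"
  shows "reduced_hom_vanishes \<Delta> i"
  unfolding reduced_hom_vanishes_def
proof (intro allI impI)
  fix c :: "nat set \<Rightarrow> int"
  assume cycle: "\<forall>G\<in>cfaces \<Delta> i. bdry \<Delta> (i + 1) c G = 0"
  define b where "b H = (if 0 \<in> H then c (H - {0}) else 0)" for H
  have "c F = bdry \<Delta> (i + 2) b F" if "F \<in> cfaces \<Delta> (i + 1)" for F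
  proof -
    have F: "F \<subseteq> {..<n}" "card F = Suc i" "finite F"
      using that \<Delta> by (auto simp: cfaces_def intro: finite_subset)
    have bd: "bdry \<Delta> (i + 2) b F
        = (\<Sum>v\<in>{..<n} - F. if insert v F \<in> \<Delta> then inc (insert v F) F * b (insert v F) else 0)"
      using sum_cofaces[OF \<Delta> F(1,2), of "\<lambda>H. inc H F * b H"]
      by (simp add: bdry_def inc_eq_0)
    show ?thesis
    proof (cases "0 \<in> F")
      case False
      \<comment> \<open>Only the coface through 0 carries a value of \<open>b\<close>, and its
        incidence number is +1 because no vertex precedes 0.\<close>
      have "bdry \<Delta> (i + 2) b F = (\<Sum>v\<in>{..<n} - F. if v = 0 then c F else 0)"
        unfolding bd
      proof (rule sum.cong)
        fix v assume v: "v \<in> {..<n} - F"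
        show "(if insert v F \<in> \<Delta> then inc (insert v F) F * b (insert v F) else 0)
            = (if v = 0 then c F else 0)"
        proof (cases "v = 0")
          case True
          then have "insert v F \<in> \<Delta>"
            using v F by (intro cone) auto
          then show ?thesis
            using True v F by (simp add: b_def inc_insert)
        next
          case F0: False
          then show ?thesis
            using False by (simp add: b_def)
        qed
      qed simp
      also have "\<dots> = c F"
        using False \<open>n > 0\<close> by simp
      finally show ?thesis
        by simp
    next
      case True
      \<comment> \<open>The cycle condition at \<open>G\<close> expresses \<open>c F\<close> through
        the remaining cofaces of \<open>G\<close>.\<close>
      define G where "G = F - {0}"
      have G: "G \<subseteq> {..<n}" "card G = i" "finite G" "0 \<notin> G" "insert 0 G = F"
        using F True by (auto simp: G_def)
      then have "G \<in> cfaces \<Delta> i"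
        using skel by (simp add: cfaces_def)
      then have "0 = (\<Sum>H\<in>cfaces \<Delta> (Suc i). inc H G * c H)"
        using cycle by (simp add: bdry_def)
      also have "\<dots> = (\<Sum>v\<in>{..<n} - G. if insert v G \<in> \<Delta> then inc (insert v G) G * c (insert v G) else 0)"
        by (rule sum_cofaces[OF \<Delta> G(1,2)]) (simp add: inc_eq_0)
      also have "\<dots> = (\<Sum>v\<in>{..<n} - G. inc (insert v G) G * c (insert v G))"
        by (rule sum.cong) (use G in \<open>auto simp: card_insert_if intro!: skel\<close>)
      also have "{..<n} - G = insert 0 ({..<n} - F)"
        using G F \<open>n > 0\<close> by auto
      also have "(\<Sum>v\<in>insert 0 ({..<n} - F). inc (insert v G) G * c (insert v G))
          = c F + (\<Sum>v\<in>{..<n} - F. inc (insert v G) G * c (insert v G))"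
        using G True by (subst sum.insert) (auto simp: inc_insert)
      finally have "c F = (\<Sum>v\<in>{..<n} - F. - (inc (insert v G) G * c (insert v G)))"
        by (simp add: sum_negf)
      also have "\<dots> = bdry \<Delta> (i + 2) b F"
        unfolding bd
      proof (rule sum.cong)
        fix v assume v: "v \<in> {..<n} - F"
        then have v0: "v > 0"
          using True by (cases v) auto
        have "insert v F \<in> \<Delta>"
          using v F True by (intro cone) auto
        moreover have "insert v F - {0} = insert v G"
          using v0 G_def by auto
        \<comment> \<open>Passing from \<open>G\<close> to \<open>F\<close> adds one vertex below
          \<open>v\<close>, namely 0, which supplies the sign.\<close>
        moreover have "inc (insert v F) F = - (inc (insert v G) G :: int)"
        proof -
          have "{y\<in>F. y < v} = insert 0 {y\<in>G. y < v}"
            using G v0 by auto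
          then have "card {y\<in>F. y < v} = Suc (card {y\<in>G. y < v})"
            using G by simp
          then show ?thesis
            using v F G by (simp add: inc_insert G_def)
        qed
        ultimately show "- (inc (insert v G) G * c (insert v G))
            = (if insert v F \<in> \<Delta> then inc (insert v F) F * b (insert v F) else 0)"
          using True by (simp add: b_def)
      qed simp
      finally show ?thesis .
    qed
  qed
  then show "\<exists>b. \<forall>F\<in>cfaces \<Delta> (i + 1). c F = bdry \<Delta> (i + 2) b F"
    by blast
qed

text \<open>Writing the values in signs turns the parity of the set of facets where \<open>g\<close>
  holds into a product over facets, to which multiplicativity of \<open>\<chi>\<close>
  applies.\<close>

lemma sign_cob2:
  assumes H: "finite H" "card H = Suc m" and \<Delta>: "\<And>w. w \<in> H \<Longrightarrow> H - {w} \<in> \<Delta>"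
  shows "(if cob2 \<Delta> m g H then -1 else 1 :: real) = (\<Prod>w\<in>H. if g (H - {w}) then -1 else 1)"
proof -
  have "{G\<in>cfaces \<Delta> m. inc H G \<noteq> (0::int) \<and> g G} = (\<lambda>w. H - {w}) ` {w\<in>H. g (H - {w})}" (is "?A = ?B")
  proof
    show "?A \<subseteq> ?B"
    proof
      fix G assume "G \<in> ?A"
      then have G: "G \<subseteq> H" "card H = card G + 1" "g G"
        by (auto simp: inc_def split: if_splits)
      then have "card (H - G) = 1"
        using H by (simp add: card_Diff_subset finite_subset)
      then obtain w where "H - G = {w}"
        by (auto simp: card_1_singleton_iff)
      then have "w \<in> H" "G = H - {w}"
        using G by auto
      with G show "G \<in> ?B"
        by auto
    qed
    show "?B \<subseteq> ?A"
      using H \<Delta> by (auto simp: cfaces_def inc_def)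
  qed
  moreover have "inj_on (\<lambda>w. H - {w}) {w\<in>H. g (H - {w})}"
    by (rule inj_onI) blast
  ultimately have "card {G\<in>cfaces \<Delta> m. inc H G \<noteq> (0::int) \<and> g G} = card {w\<in>H. g (H - {w})}"
    by (simp add: card_image)
  moreover have "(\<Prod>w\<in>H. if g (H - {w}) then -1 else 1 :: real) = (-1) ^ card {w\<in>H. g (H - {w})}"
    using H by (simp add: prod.If_cases Int_def)
  ultimately show ?thesis
    by (simp add: cob2_def)
qed

lemma deg_eq_sum:
  assumes \<Delta>: "\<Delta> \<subseteq> Pow {..<n}" and F: "F \<subseteq> {..<n}" "card F = k"
  shows "real (deg \<Delta> k F) = (\<Sum>v\<in>{..<n} - F. of_bool (insert v F \<in> \<Delta>))"
proof -
  have "real (deg \<Delta> k F) = (\<Sum>H\<in>cfaces \<Delta> (Suc k). of_bool (F \<subseteq> H))"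
    using finite_cfaces[OF \<Delta>] by (simp add: deg_def Int_def)
  also have "\<dots> = (\<Sum>v\<in>{..<n} - F. of_bool (insert v F \<in> \<Delta>))"
    by (subst sum_cofaces[OF \<Delta> F]) (auto intro!: sum.cong simp del: sum_of_bool_eq)
  finally show ?thesis .
qed

section \<open>The complex and its links\<close>

context character_complex
begin

text \<open>The exceptional sets give the cones at the vertex 0 and full degree at exceptional
  faces. All other top faces have \<open>\<chi> (esym F) = 1\<close>, so the coboundary of
  \<open>cochain\<close> vanishes on them.\<close>

definition Y :: "nat set set" where
  "Y = {F. F \<subseteq> {..<n} \<and> (card F \<le> k \<or> card F = Suc k \<and> (exceptional F \<or> \<chi> (esym F) = 1))}"

definition cochain :: "nat set \<Rightarrow> bool" where
  "cochain G \<longleftrightarrow> \<chi> (xprod G) = -1"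

section \<open>Combinatorial and homological properties of the complex\<close>

lemma Y_Pow: "Y \<subseteq> Pow {..<n}"
  by (auto simp: Y_def)

lemma in_Y_skeleton: "F \<subseteq> {..<n} \<Longrightarrow> card F \<le> k \<Longrightarrow> F \<in> Y"
  by (simp add: Y_def)

lemma in_Y_top:
  "H \<subseteq> {..<n} \<Longrightarrow> card H = Suc k \<Longrightarrow> H \<in> Y \<longleftrightarrow> exceptional H \<or> \<chi> (esym H) = 1"
  by (simp add: Y_def)

lemma cfaces_Y: "m \<le> k \<Longrightarrow> cfaces Y m = {F. F \<subseteq> {..<n} \<and> card F = m}"
  by (auto simp: cfaces_def Y_def)

lemma card_cfaces_Y: "m \<le> k \<Longrightarrow> card (cfaces Y m) = n choose m"
  using n_subsets[of "{..<n}" m] by (simp add: cfaces_Y)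

lemma simplicial_complex_Y: "simplicial_complex n Y"
  unfolding simplicial_complex_def
proof (intro conjI ballI allI impI)
  fix F G assume FG: "F \<in> Y" "G \<subseteq> F"
  then have "F \<subseteq> {..<n}"
    using Y_Pow by auto
  then have "finite F"
    using finite_subset by blast
  show "G \<in> Y"
  proof (cases "G = F")
    case False
    then have "card G < card F"
      using FG \<open>finite F\<close> by (intro psubset_card_mono) auto
    then show ?thesis
      using FG \<open>F \<subseteq> {..<n}\<close> by (intro in_Y_skeleton) (auto simp: Y_def)
  qed (use FG in simp)
qed (use k_ge_2 Y_Pow in \<open>auto intro!: in_Y_skeleton\<close>)

lemma complete_skeleton_Y: "complete_skeleton n k Y"
  by (simp add: complete_skeleton_def in_Y_skeleton)

lemma in_Y_cone: "F \<subseteq> {..<n} \<Longrightarrow> card F \<le> Suc k \<Longrightarrow> 0 \<in> F \<Longrightarrow> F \<in> Y"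
  by (auto simp: Y_def exceptional_def)

lemma pure_dim_Y: "pure_dim k Y"
  unfolding pure_dim_def
proof (intro conjI ballI)
  fix F assume F: "F \<in> Y"
  show "card F \<le> k + 1"
    using F by (auto simp: Y_def)
  have sub: "F \<subseteq> {..<n}"
    using F by (auto simp: Y_def)
  then have fin: "finite F"
    using finite_subset by blast
  show "\<exists>H\<in>Y. card H = k + 1 \<and> F \<subseteq> H"
  proof (cases "card F = k + 1")
    case False
    \<comment> \<open>Any set of size \<open>k + 1\<close> containing \<open>insert 0 F\<close> is a
      face by the cone property.\<close>
    then have "card (insert 0 F) \<le> k + 1"
      using F fin by (auto simp: Y_def card_insert_if)
    moreover have "insert 0 F \<subseteq> {..<n}"
      using sub n_ge k_ge_2 by auto
    ultimately obtain H where "insert 0 F \<subseteq> H" "H \<subseteq> {..<n}" "card H = k + 1"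
      using exists_subset_between[of "insert 0 F" "k + 1" "{..<n}"] n_ge k_ge_2 by auto
    then show ?thesis
      by (intro bexI[of _ H]) (auto intro: in_Y_cone)
  qed (use F in auto)
qed

lemma reduced_hom_vanishes_Y: "i \<le> k - 1 \<Longrightarrow> reduced_hom_vanishes Y i"
  using k_ge_2 n_ge by (intro reduced_hom_vanishes_cone[OF Y_Pow]) (auto intro: in_Y_skeleton in_Y_cone)

lemma chi_esym_insert:
  assumes "finite F" "v \<notin> F"
  shows "\<chi> (esym (insert v F)) = \<chi> (xprod F) * \<chi> (esym F * x v)"
  unfolding esym_insert[OF assms]
  by (subst chi_add) (auto simp: xprod_K mult_K esym_K x_K mult.commute)

text \<open>As a matrix in \<open>u\<close> and \<open>v\<close>, the sign of
  \<open>insert u (insert v T)\<close> is a character matrix conjugated by the diagonal signs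
  \<open>\<chi> (xprod T * x u)\<close>.\<close>

lemma chi_esym_insert2:
  assumes "finite T" "v \<notin> T" "u \<notin> T" "u \<noteq> v"
  shows "\<chi> (esym (insert u (insert v T)))
    = \<chi> (xprod T * x u) * \<chi> (xprod T * x v) * \<chi> (esym T * x u * x v)"
proof -
  have "esym (insert u (insert v T)) = xprod T * x u + xprod T * x v + esym T * x u * x v"
    using assms by (simp add: esym_insert xprod_insert algebra_simps)
  then show ?thesis
    by (simp add: chi_add xprod_K mult_K esym_K x_K add_K)
qed

text \<open>An exceptional \<open>F\<close> extends by every vertex. Otherwise the signs of the
  cofaces are a fixed sign times a nontrivial character of \<open>x v\<close>, so equidistribution
  gives at least \<open>(n - k - (n / 2 + k)) / 2 = n / 4 - k\<close> cofaces, and \<open>k\<close>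
  is at most \<open>n / 8\<close>.\<close>

lemma deg_Y_ge:
  assumes F: "F \<subseteq> {..<n}" "card F = k"
  shows "real (deg Y k F) \<ge> real n / 8"
proof -
  have fin: "finite F"
    using F finite_subset by blast
  have nk: "card ({..<n} - F) = n - k"
    using F fin by (simp add: card_Diff_subset)
  have kn: "8 * real k \<le> real n"
    using n_ge by linarith
  show ?thesis
  proof (cases "exceptional F")
    case True
    have "real (deg Y k F) = (\<Sum>v\<in>{..<n} - F. 1)"
      unfolding deg_eq_sum[OF Y_Pow F]
    proof (rule sum.cong)
      fix v assume v: "v \<in> {..<n} - F"
      then have "insert v F \<in> Y"
        using F fin exceptional_mono[OF True, of "insert v F"] by (subst in_Y_top) auto
      then show "of_bool (insert v F \<in> Y) = 1"
        by simp
    qed simp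
    then show ?thesis
      using nk kn by simp
  next
    case False
    have "F \<noteq> {}"
      using F k_ge_2 by auto
    then have e: "esym F \<noteq> 0"
      using False by (auto simp: exceptional_def)
    define s where "s = (\<Sum>v\<in>{..<n} - F. \<chi> (esym F * x v))"
    have "(\<Sum>v<n. \<chi> (esym F * x v)) = s + (\<Sum>v\<in>F. \<chi> (esym F * x v))"
      unfolding s_def using F by (intro sum.subset_diff) auto
    moreover have "\<bar>\<Sum>v\<in>F. \<chi> (esym F * x v)\<bar> \<le> real k"
      by (rule order_trans[OF sum_abs]) (simp add: F(2))
    ultimately have "\<bar>s\<bar> \<le> real n / 2 + real k"
      using equidistributed[OF esym_K[of F] e] by linarith
    then have "\<bar>\<chi> (xprod F) * s\<bar> \<le> real n / 2 + real k"
      by (simp add: abs_mult)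
    moreover have "real (deg Y k F) \<ge> (\<Sum>v\<in>{..<n} - F. (1 + \<chi> (xprod F) * \<chi> (esym F * x v)) / 2)"
      unfolding deg_eq_sum[OF Y_Pow F]
    proof (rule sum_mono)
      fix v assume v: "v \<in> {..<n} - F"
      have "of_bool (insert v F \<in> Y) \<ge> (1 + \<chi> (esym (insert v F))) / 2"
        using v F fin chi_pm[of "esym (insert v F)"] by (auto simp: in_Y_top)
      then show "(1 + \<chi> (xprod F) * \<chi> (esym F * x v)) / 2 \<le> of_bool (insert v F \<in> Y)"
        using v fin by (simp add: chi_esym_insert)
    qed
    moreover have "(\<Sum>v\<in>{..<n} - F. (1 + \<chi> (xprod F) * \<chi> (esym F * x v)) / 2)
        = (real (n - k) + \<chi> (xprod F) * s) / 2"
      unfolding s_def using nk by (simp add: sum_divide_distrib[symmetric] sum.distrib sum_distrib_left)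
    ultimately show ?thesis
      using kn by (simp add: of_nat_diff)
  qed
qed

section \<open>Adjacency matrices of the links\<close>

definition link :: "nat set \<Rightarrow> nat \<Rightarrow> nat \<Rightarrow> real" where
  "link T u v = of_bool (u \<noteq> v \<and> insert u (insert v T) \<in> Y)"

abbreviation e0 :: real where
  "e0 \<equiv> form_const k B"

lemma e0_ge_1: "e0 \<ge> 1"
  by (simp add: form_const_def add_increasing)

text \<open>The link of an exceptional \<open>T\<close> is a complete graph, with
  \<open>\<alpha> = 1\<close>; otherwise \<open>\<alpha> = 1 / 2\<close> and the error is half a
  character matrix plus a sparse correction.\<close>

lemma link_form:
  assumes T: "T \<subseteq> {..<n}" "card T = k - 1"
  obtains \<alpha> E where "\<alpha> \<ge> 1 / 2" "form_bound ({..<n} - T) E (e0 * sqrt (real n))"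
    "\<And>u v. u \<in> {..<n} - T \<Longrightarrow> v \<in> {..<n} - T \<Longrightarrow> link T u v = \<alpha> + E u v"
proof -
  define U where "U = {..<n} - T"
  have fin: "finite T" "finite U"
    using T finite_subset by (auto simp: U_def)
  have cU: "card U \<le> n"
    unfolding U_def using card_mono[of "{..<n}" "{..<n} - T"] by auto
  have top: "insert u (insert v T) \<in> Y \<longleftrightarrow> exceptional (insert u (insert v T))
        \<or> \<chi> (esym (insert u (insert v T))) = 1" if "u \<in> U" "v \<in> U" "u \<noteq> v" for u v
    using that T fin k_ge_2 by (intro in_Y_top) (auto simp: U_def)
  show thesis
  proof (cases "exceptional T")
    case True
    define E where "E u v = - (of_bool (u = v) :: real)" for u v :: nat
    have "link T u v = 1 + E u v" if "u \<in> U" "v \<in> U" for u v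
      using exceptional_mono[OF True, of "insert u (insert v T)"] that top
      by (auto simp: link_def E_def)
    moreover have "form_bound U E (sqrt (real n))"
    proof (rule form_bound_Frobenius)
      show "(\<lambda>u. (u, u)) ` U \<subseteq> U \<times> U"
        by auto
      show "real (card ((\<lambda>u. (u, u)) ` U)) \<le> real n"
        using card_image_le[OF fin(2), of "\<lambda>u. (u, u)"] cU by linarith
    qed (use fin in \<open>auto simp: E_def\<close>)
    then have "form_bound U E (e0 * sqrt (real n))"
      by (rule form_bound_mono) (use e0_ge_1 in \<open>simp add: mult_le_cancel_right1\<close>)
    ultimately show ?thesis
      using that[of 1 E] by (simp add: U_def)
  next
    case False
    have "T \<noteq> {}"
      using T k_ge_2 by auto
    then have e: "esym T \<noteq> 0"
      using False by (auto simp: exceptional_def)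
    define p where "p u = \<chi> (xprod T * x u)" for u
    define S where "S u v = p u * p v * \<chi> (esym T * x u * x v)" for u v
    \<comment> \<open>For a sign \<open>S u v\<close>, the expression \<open>(1 + S u v) / 2\<close>
      is the indicator of \<open>S u v = 1\<close>; hence \<open>P\<close> vanishes off the diagonal
      unless the extended set is exceptional.\<close>
    define P where "P u v = link T u v - (1 + S u v) / 2" for u v
    define E where "E u v = 1 / 2 * S u v + P u v" for u v
    have S_eq: "S u v = \<chi> (esym (insert u (insert v T)))" if "u \<in> U" "v \<in> U" "u \<noteq> v" for u v
      unfolding S_def p_def using that fin by (subst chi_esym_insert2) (auto simp: U_def)
    have S_pm: "S u v = 1 \<or> S u v = -1" for u v
      unfolding S_def p_def
      using chi_pm[of "xprod T * x u"] chi_pm[of "xprod T * x v"] chi_pm[of "esym T * x u * x v"] by auto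
    have S: "form_bound U S (real B * sqrt (real n))"
      unfolding S_def
      by (intro form_bound_signs character_form_bound esym_K e) (auto simp: U_def p_def)
    \<comment> \<open>Adding first \<open>v\<close> and then \<open>u\<close> to \<open>T\<close>,
      exceptionality arises at one of the two steps, each with at most \<open>n * r\<close> pairs;
      the diagonal adds at most \<open>n\<close>.\<close>
    define Z where "Z = {(u, v). u \<in> U \<and> v \<in> U \<and> (u = v \<or> v \<in> exc_ext T \<or> u \<in> exc_ext (insert v T))}"
    have P: "form_bound U P (sqrt ((2 * real r + 1) * real n))"
    proof (rule form_bound_Frobenius)
      show "Z \<subseteq> U \<times> U"
        by (auto simp: Z_def)
      have "Z \<subseteq> (\<lambda>u. (u, u)) ` U \<union> U \<times> exc_ext T \<union> (\<Union>v\<in>U. exc_ext (insert v T) \<times> {v})"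
        by (auto simp: Z_def)
      then have "card Z \<le> card ((\<lambda>u. (u, u)) ` U \<union> U \<times> exc_ext T \<union> (\<Union>v\<in>U. exc_ext (insert v T) \<times> {v}))"
        using fin by (intro card_mono) auto
      also have "\<dots> \<le> card ((\<lambda>u. (u, u)) ` U) + card (U \<times> exc_ext T) + card (\<Union>v\<in>U. exc_ext (insert v T) \<times> {v})"
        by (meson card_Un_le add_mono order_refl order_trans)
      also have "card ((\<lambda>u. (u, u)) ` U) \<le> n"
        using card_image_le[OF fin(2), of "\<lambda>u. (u, u)"] cU by linarith
      also have "card (U \<times> exc_ext T) \<le> n * r"
        unfolding card_cartesian_product
        using fin T cU by (intro mult_mono card_exc_ext_le) auto
      also have "card (\<Union>v\<in>U. exc_ext (insert v T) \<times> {v}) \<le> (\<Sum>v\<in>U. card (exc_ext (insert v T) \<times> {v}))"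
        using fin by (intro card_UN_le) auto
      also have "\<dots> \<le> (\<Sum>v\<in>U. r)"
      proof (rule sum_mono)
        fix v assume "v \<in> U"
        then have "card (exc_ext (insert v T)) \<le> r"
          using fin T k_ge_2 by (intro card_exc_ext_le) (auto simp: card_insert_if)
        then show "card (exc_ext (insert v T) \<times> {v}) \<le> r"
          by (simp add: card_cartesian_product)
      qed
      also have "\<dots> \<le> n * r"
        using cU by simp
      finally have "card Z \<le> n + n * r + n * r"
        by simp
      then have "real (card Z) \<le> real (n + n * r + n * r)"
        by (simp only: of_nat_le_iff)
      then show "real (card Z) \<le> (2 * real r + 1) * real n"
        by (simp add: algebra_simps)
      show "\<bar>P u v\<bar> \<le> 1" for u v
        using S_pm[of u v] by (auto simp: P_def link_def)
      show "P u v = 0" if "u \<in> U" "v \<in> U" "(u, v) \<notin> Z" for u v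
      proof -
        have uv: "u \<noteq> v" "v \<notin> exc_ext T" "u \<notin> exc_ext (insert v T)" "u < n" "v < n" "u \<notin> T" "v \<notin> T"
          using that by (auto simp: Z_def U_def)
        then have "\<not> exceptional (insert u (insert v T))"
          using False by (simp add: exceptional_insert)
        then have "link T u v = of_bool (S u v = 1)"
          using uv top[OF that(1,2)] S_eq[OF that(1,2)] by (simp add: link_def)
        then show ?thesis
          using S_pm[of u v] by (auto simp: P_def)
      qed
    qed (use fin in auto)
    have "form_bound U E (\<bar>1 / 2\<bar> * (real B * sqrt (real n)) + sqrt ((2 * real r + 1) * real n))"
      unfolding E_def by (intro form_bound_add form_bound_scale S P)
    moreover have "\<bar>1 / 2\<bar> * (real B * sqrt (real n)) + sqrt ((2 * real r + 1) * real n) = e0 * sqrt (real n)"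
      unfolding form_const_def real_sqrt_mult by (simp add: algebra_simps)
    ultimately have "form_bound U E (e0 * sqrt (real n))"
      by simp
    moreover have "link T u v = 1 / 2 + E u v" for u v
      by (simp add: E_def P_def field_simps)
    ultimately show ?thesis
      using that[of "1 / 2" E] by (simp add: U_def)
  qed
qed

abbreviation L :: real where
  "L \<equiv> link_const k B"

lemma link_quadratic_form:
  assumes T: "T \<subseteq> {..<n}" "card T = k - 1"
    and orth: "(\<Sum>u\<in>{..<n} - T. (\<Sum>v\<in>{..<n} - T. link T u v) * f u) = 0"
  shows "\<bar>\<Sum>u\<in>{..<n} - T. \<Sum>v\<in>{..<n} - T. link T u v * f u * f v\<bar>
    \<le> L * sqrt (real n) * (\<Sum>u\<in>{..<n} - T. (f u)\<^sup>2)"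
proof -
  define U where "U = {..<n} - T"
  obtain \<alpha> E where E: "\<alpha> \<ge> 1 / 2" "form_bound U E (e0 * sqrt (real n))"
    "\<And>u v. u \<in> U \<Longrightarrow> v \<in> U \<Longrightarrow> link T u v = \<alpha> + E u v"
    using link_form[OF T] unfolding U_def by blast
  have n0: "real n \<ge> 1"
    using n_ge k_ge_2 by simp
  have "card U = n - (k - 1)"
    unfolding U_def using T by (subst card_Diff_subset) (auto intro: finite_subset)
  then have cU: "real (card U) \<ge> real n / 2"
    using n_ge k_ge_2 by (simp add: of_nat_diff)
  have "U \<noteq> {}"
    using cU n0 by auto
  then have "\<bar>\<Sum>u\<in>U. \<Sum>v\<in>U. link T u v * f u * f v\<bar>
      \<le> ((e0 * sqrt (real n))\<^sup>2 / (\<alpha> * real (card U)) + e0 * sqrt (real n)) * (\<Sum>u\<in>U. (f u)\<^sup>2)"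
    by (intro quadratic_form_orthogonal_to_row_sums E(2,3))
      (use E e0_ge_1 orth in \<open>auto simp: U_def\<close>)
  also have "\<dots> \<le> (L * sqrt (real n)) * (\<Sum>u\<in>U. (f u)\<^sup>2)"
  proof (intro mult_right_mono sum_nonneg)
    \<comment> \<open>Both factors are at least half of their ideal values, so the quadratic error
      term stays below the constant \<open>4 * e0^2\<close>.\<close>
    have "real n / 4 \<le> \<alpha> * real (card U)"
      using mult_mono[OF E(1) cU] E(1) by simp
    then have "(e0 * sqrt (real n))\<^sup>2 / (\<alpha> * real (card U)) \<le> (e0 * sqrt (real n))\<^sup>2 / (real n / 4)"
      using n0 by (intro frac_le) auto
    also have "\<dots> = 4 * e0\<^sup>2"
      using n0 by (simp add: power_mult_distrib)
    also have "\<dots> \<le> 4 * e0\<^sup>2 * sqrt (real n)"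
      using n0 by (simp add: mult_le_cancel_left1)
    finally show "(e0 * sqrt (real n))\<^sup>2 / (\<alpha> * real (card U)) + e0 * sqrt (real n) \<le> L * sqrt (real n)"
      by (simp add: link_const_def distrib_right)
  qed auto
  finally show ?thesis
    by (simp add: U_def)
qed

end

section \<open>Eigenvalues and the coboundary of the cochain\<close>

context character_complex
begin

lemma finite_cfaces_Y [simp]: "finite (cfaces Y m)"
  by (rule finite_cfaces[OF Y_Pow])

lemma cfaces_Y_memD:
  assumes "F \<in> cfaces Y m"
  shows "F \<subseteq> {..<n}" "card F = m" "finite F" "F \<in> Y"
  using assms Y_Pow by (auto simp: cfaces_def intro: finite_subset)

lemma sum_k_faces:
  fixes \<phi> :: "nat set \<Rightarrow> real"
  assumes T: "T \<in> cfaces Y (k - 1)" and "\<And>F. F \<in> cfaces Y k \<Longrightarrow> \<not> T \<subseteq> F \<Longrightarrow> \<phi> F = 0"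
  shows "(\<Sum>F\<in>cfaces Y k. \<phi> F) = (\<Sum>u\<in>{..<n} - T. \<phi> (insert u T))"
proof -
  note T' = cfaces_Y_memD[OF T]
  have k: "Suc (k - 1) = k"
    using k_ge_2 by simp
  have "(\<Sum>F\<in>cfaces Y k. \<phi> F) = (\<Sum>u\<in>{..<n} - T. if insert u T \<in> Y then \<phi> (insert u T) else 0)"
    using sum_cofaces[OF Y_Pow T'(1,2), of \<phi>] assms(2) unfolding k by blast
  also have "\<dots> = (\<Sum>u\<in>{..<n} - T. \<phi> (insert u T))"
    using T' k_ge_2 by (intro sum.cong) (auto simp: card_insert_if intro!: in_Y_skeleton)
  finally show ?thesis .
qed

text \<open>The incidence sign makes this a function on the vertices of the link for which the signs
  in \<open>adjA\<close> disappear.\<close>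

definition localize :: "(nat set \<Rightarrow> real) \<Rightarrow> nat set \<Rightarrow> nat \<Rightarrow> real" where
  "localize f T u = inc (insert u T) T * f (insert u T)"

text \<open>Testing against the coboundary of the indicator of \<open>T\<close> suffices: the degree
  of \<open>insert u T\<close> is the row sum of the link matrix at \<open>u\<close>.\<close>

lemma localize_orthogonal:
  assumes orth: "\<And>g. winner Y k f (cobdry Y (k - 1) g) = 0" and T: "T \<in> cfaces Y (k - 1)"
  shows "(\<Sum>u\<in>{..<n} - T. (\<Sum>v\<in>{..<n} - T. link T u v) * localize f T u) = 0"
proof -
  note T' = cfaces_Y_memD[OF T]
  define g :: "nat set \<Rightarrow> real" where "g G = of_bool (G = T)" for G
  have g: "cobdry Y (k - 1) g F = inc F T" for F
  proof -
    have "cobdry Y (k - 1) g F = (\<Sum>G\<in>cfaces Y (k - 1). if G = T then inc F T else 0)"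
      unfolding cobdry_def by (rule sum.cong) (auto simp: g_def)
    then show ?thesis
      using T by simp
  qed
  have "0 = (\<Sum>F\<in>cfaces Y k. real (deg Y k F) * f F * inc F T)"
    using orth[of g] unfolding winner_def g by simp
  also have "\<dots> = (\<Sum>u\<in>{..<n} - T. real (deg Y k (insert u T)) * f (insert u T) * inc (insert u T) T)"
    by (rule sum_k_faces[OF T]) (simp add: inc_eq_0)
  also have "\<dots> = (\<Sum>u\<in>{..<n} - T. (\<Sum>v\<in>{..<n} - T. link T u v) * localize f T u)"
  proof (rule sum.cong)
    fix u assume u: "u \<in> {..<n} - T"
    have "real (deg Y k (insert u T)) = (\<Sum>v\<in>{..<n} - insert u T. of_bool (insert v (insert u T) \<in> Y))"
      using u T' k_ge_2 by (intro deg_eq_sum[OF Y_Pow]) auto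
    also have "\<dots> = (\<Sum>v\<in>{..<n} - insert u T. link T u v)"
      by (rule sum.cong) (auto simp: link_def insert_commute)
    also have "\<dots> = (\<Sum>v\<in>{..<n} - T. link T u v)"
      using u by (intro sum.mono_neutral_left) (auto simp: link_def)
    finally show "real (deg Y k (insert u T)) * f (insert u T) * inc (insert u T) T
        = (\<Sum>v\<in>{..<n} - T. link T u v) * localize f T u"
      by (simp add: localize_def)
  qed simp
  finally show ?thesis
    by simp
qed

text \<open>Adjacent faces \<open>F\<close> and \<open>G\<close> meet in a unique \<open>T\<close>
  of size \<open>k - 1\<close>. Grouping the pairs by this intersection splits the form into link
  forms.\<close>

lemma adjA_quadratic_form_localize:
  "(\<Sum>F\<in>cfaces Y k. \<Sum>G\<in>cfaces Y k. adjA Y k F G * f F * f G)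
    = (\<Sum>T\<in>cfaces Y (k - 1). \<Sum>u\<in>{..<n} - T. \<Sum>v\<in>{..<n} - T.
         link T u v * localize f T u * localize f T v)"
proof -
  define \<psi> where "\<psi> T F G = (if F \<inter> G = T then adjA Y k F G * f F * f G else 0)" for T F G
  have "(\<Sum>F\<in>cfaces Y k. \<Sum>G\<in>cfaces Y k. adjA Y k F G * f F * f G)
      = (\<Sum>F\<in>cfaces Y k. \<Sum>G\<in>cfaces Y k. \<Sum>T\<in>cfaces Y (k - 1). \<psi> T F G)"
  proof (intro sum.cong refl)
    fix F G assume F: "F \<in> cfaces Y k" and "G \<in> cfaces Y k"
    have "F \<inter> G \<in> cfaces Y (k - 1)" if "card (F \<inter> G) = k - 1"
      using that cfaces_Y_memD[OF F] by (subst cfaces_Y) auto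
    then show "adjA Y k F G * f F * f G = (\<Sum>T\<in>cfaces Y (k - 1). \<psi> T F G)"
      by (cases "card (F \<inter> G) = k - 1") (auto simp: \<psi>_def adjA_def)
  qed
  also have "\<dots> = (\<Sum>F\<in>cfaces Y k. \<Sum>T\<in>cfaces Y (k - 1). \<Sum>G\<in>cfaces Y k. \<psi> T F G)"
    by (intro sum.cong refl sum.swap)
  also have "\<dots> = (\<Sum>T\<in>cfaces Y (k - 1). \<Sum>F\<in>cfaces Y k. \<Sum>G\<in>cfaces Y k. \<psi> T F G)"
    by (rule sum.swap)
  also have "\<dots> = (\<Sum>T\<in>cfaces Y (k - 1). \<Sum>u\<in>{..<n} - T. \<Sum>v\<in>{..<n} - T.
         link T u v * localize f T u * localize f T v)"
  proof (rule sum.cong)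
    fix T assume T: "T \<in> cfaces Y (k - 1)"
    note T' = cfaces_Y_memD[OF T]
    have "(\<Sum>F\<in>cfaces Y k. \<Sum>G\<in>cfaces Y k. \<psi> T F G)
        = (\<Sum>u\<in>{..<n} - T. \<Sum>G\<in>cfaces Y k. \<psi> T (insert u T) G)"
      by (rule sum_k_faces[OF T]) (auto simp: \<psi>_def intro!: sum.neutral)
    also have "\<dots> = (\<Sum>u\<in>{..<n} - T. \<Sum>v\<in>{..<n} - T. \<psi> T (insert u T) (insert v T))"
      by (intro sum.cong refl sum_k_faces[OF T]) (auto simp: \<psi>_def)
    also have "\<dots> = (\<Sum>u\<in>{..<n} - T. \<Sum>v\<in>{..<n} - T. link T u v * localize f T u * localize f T v)"
    proof (intro sum.cong refl)
      fix u v assume uv: "u \<in> {..<n} - T" "v \<in> {..<n} - T"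
      show "\<psi> T (insert u T) (insert v T) = link T u v * localize f T u * localize f T v"
      proof (cases "u = v")
        case False
        then have "insert u T \<inter> insert v T = T" "insert u T \<union> insert v T = insert u (insert v T)"
          using uv by auto
        moreover have "card (insert u (insert v T)) = k + 1"
          using uv T' False k_ge_2 by simp
        ultimately show ?thesis
          using T' False by (simp add: \<psi>_def adjA_def link_def localize_def cfaces_def)
      next
        case True
        then have "insert u T \<inter> insert v T \<noteq> T"
          using uv by auto
        then show ?thesis
          using True by (simp add: \<psi>_def link_def)
      qed
    qed
    finally show "(\<Sum>F\<in>cfaces Y k. \<Sum>G\<in>cfaces Y k. \<psi> T F G)
        = (\<Sum>u\<in>{..<n} - T. \<Sum>v\<in>{..<n} - T. link T u v * localize f T u * localize f T v)" .
  qed simp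
  finally show ?thesis .
qed

text \<open>Double counting: the incidence signs square to 1 and every \<open>F\<close> contains
  \<open>k\<close> sets \<open>T\<close>.\<close>

lemma sum_localize_sq:
  "(\<Sum>T\<in>cfaces Y (k - 1). \<Sum>u\<in>{..<n} - T. (localize f T u)\<^sup>2) = real k * (\<Sum>F\<in>cfaces Y k. (f F)\<^sup>2)"
proof -
  have "(\<Sum>T\<in>cfaces Y (k - 1). \<Sum>u\<in>{..<n} - T. (localize f T u)\<^sup>2)
      = (\<Sum>T\<in>cfaces Y (k - 1). \<Sum>F\<in>cfaces Y k. of_bool (T \<subseteq> F) * (f F)\<^sup>2)"
  proof (rule sum.cong)
    fix T assume T: "T \<in> cfaces Y (k - 1)"
    have "(\<Sum>F\<in>cfaces Y k. of_bool (T \<subseteq> F) * (f F)\<^sup>2)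
        = (\<Sum>u\<in>{..<n} - T. of_bool (T \<subseteq> insert u T) * (f (insert u T))\<^sup>2)"
      by (rule sum_k_faces[OF T]) auto
    also have "\<dots> = (\<Sum>u\<in>{..<n} - T. (localize f T u)\<^sup>2)"
      using cfaces_Y_memD[OF T]
      by (intro sum.cong) (auto simp: localize_def power_mult_distrib inc_sq subset_insertI)
    finally show "(\<Sum>u\<in>{..<n} - T. (localize f T u)\<^sup>2)
        = (\<Sum>F\<in>cfaces Y k. of_bool (T \<subseteq> F) * (f F)\<^sup>2)" ..
  qed simp
  also have "\<dots> = (\<Sum>F\<in>cfaces Y k. (\<Sum>T\<in>cfaces Y (k - 1). of_bool (T \<subseteq> F)) * (f F)\<^sup>2)"
    by (subst sum.swap) (simp add: sum_distrib_right)
  also have "\<dots> = (\<Sum>F\<in>cfaces Y k. real k * (f F)\<^sup>2)"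
  proof (rule sum.cong)
    fix F assume F: "F \<in> cfaces Y k"
    note F' = cfaces_Y_memD[OF F]
    have "cfaces Y (k - 1) \<inter> {T. T \<subseteq> F} = {T. T \<subseteq> F \<and> card T = k - 1}"
      using F' by (auto simp: cfaces_Y)
    then have "(\<Sum>T\<in>cfaces Y (k - 1). of_bool (T \<subseteq> F)) = real (k choose (k - 1))"
      using n_subsets[OF F'(3), of "k - 1"] F' by simp
    also have "k choose (k - 1) = k"
      using k_ge_2 by (cases k) auto
    finally show "(\<Sum>T\<in>cfaces Y (k - 1). of_bool (T \<subseteq> F)) * (f F)\<^sup>2 = real k * (f F)\<^sup>2"
      by simp
  qed simp
  finally show ?thesis
    by (simp add: sum_distrib_left)
qed

text \<open>Pairing the eigenvalue equation with \<open>f\<close> in the degree-weighted inner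
  product gives \<open>1 - lam\<close> times the weighted norm as the quadratic form of
  \<open>adjA\<close>. The link bounds control the form and \<open>deg_Y_ge\<close> controls the
  norm from below.\<close>

lemma nontrivial_eig_near_1:
  assumes "nontrivial_eig Y k lam"
  shows "\<bar>1 - lam\<bar> \<le> 8 * real k * L / sqrt (real n)"
proof -
  obtain f F0 where F0: "F0 \<in> cfaces Y k" "f F0 \<noteq> 0"
    and orth: "\<And>g. winner Y k f (cobdry Y (k - 1) g) = 0"
    and eig: "\<And>F. F \<in> cfaces Y k \<Longrightarrow> up_lap Y k f F = lam * f F"
    using assms unfolding nontrivial_eig_def by blast
  define q where "q = (\<Sum>F\<in>cfaces Y k. (f F)\<^sup>2)"
  have n0: "real n \<ge> 1"
    using n_ge k_ge_2 by simp
  have deg: "real (deg Y k F) \<ge> real n / 8" if "F \<in> cfaces Y k" for F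
    using deg_Y_ge cfaces_Y_memD[OF that] by blast
  have "q > 0"
    unfolding q_def using F0 by (intro sum_pos2[of _ F0]) auto
  have "(1 - lam) * (\<Sum>F\<in>cfaces Y k. real (deg Y k F) * (f F)\<^sup>2)
      = (\<Sum>F\<in>cfaces Y k. \<Sum>G\<in>cfaces Y k. adjA Y k F G * f F * f G)"
    unfolding sum_distrib_left
  proof (rule sum.cong)
    fix F assume F: "F \<in> cfaces Y k"
    define s where "s = (\<Sum>G\<in>cfaces Y k. adjA Y k F G * f G)"
    define d where "d = real (deg Y k F)"
    have "d > 0"
      using deg[OF F] n0 by (simp add: d_def)
    have "f F - 1 / d * s = lam * f F"
      using eig[OF F] by (simp add: up_lap_def s_def d_def)
    then have "s = (1 - lam) * d * f F"
      using \<open>d > 0\<close> by (simp add: field_simps)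
    then have "(1 - lam) * (d * (f F)\<^sup>2) = f F * s"
      by (simp add: power2_eq_square)
    also have "\<dots> = (\<Sum>G\<in>cfaces Y k. adjA Y k F G * f F * f G)"
      by (simp add: s_def sum_distrib_left mult_ac)
    finally show "(1 - lam) * (real (deg Y k F) * (f F)\<^sup>2)
        = (\<Sum>G\<in>cfaces Y k. adjA Y k F G * f F * f G)"
      by (simp add: d_def)
  qed simp
  then have "\<bar>1 - lam\<bar> * \<bar>\<Sum>F\<in>cfaces Y k. real (deg Y k F) * (f F)\<^sup>2\<bar>
      = \<bar>\<Sum>T\<in>cfaces Y (k - 1). \<Sum>u\<in>{..<n} - T. \<Sum>v\<in>{..<n} - T.
         link T u v * localize f T u * localize f T v\<bar>"
    unfolding adjA_quadratic_form_localize abs_mult[symmetric] by simp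
  also have "\<dots> \<le> (\<Sum>T\<in>cfaces Y (k - 1). L * sqrt (real n) * (\<Sum>u\<in>{..<n} - T. (localize f T u)\<^sup>2))"
  proof (rule order_trans[OF sum_abs], rule sum_mono)
    fix T assume T: "T \<in> cfaces Y (k - 1)"
    show "\<bar>\<Sum>u\<in>{..<n} - T. \<Sum>v\<in>{..<n} - T. link T u v * localize f T u * localize f T v\<bar>
      \<le> L * sqrt (real n) * (\<Sum>u\<in>{..<n} - T. (localize f T u)\<^sup>2)"
      using cfaces_Y_memD[OF T] by (intro link_quadratic_form localize_orthogonal orth T)
  qed
  also have "\<dots> = L * sqrt (real n) * (real k * q)"
    by (simp only: sum_distrib_left[symmetric] sum_localize_sq q_def)
  finally have "\<bar>1 - lam\<bar> * \<bar>\<Sum>F\<in>cfaces Y k. real (deg Y k F) * (f F)\<^sup>2\<bar> \<le> L * sqrt (real n) * (real k * q)" .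
  moreover have "real n / 8 * q \<le> \<bar>\<Sum>F\<in>cfaces Y k. real (deg Y k F) * (f F)\<^sup>2\<bar>"
    unfolding q_def sum_distrib_left
    by (rule order_trans[OF _ abs_ge_self], intro sum_mono mult_right_mono deg) auto
  then have "\<bar>1 - lam\<bar> * (real n / 8 * q) \<le> \<bar>1 - lam\<bar> * \<bar>\<Sum>F\<in>cfaces Y k. real (deg Y k F) * (f F)\<^sup>2\<bar>"
    by (rule mult_left_mono) simp
  ultimately have "(\<bar>1 - lam\<bar> * (real n / 8)) * q \<le> (L * sqrt (real n) * real k) * q"
    by (simp add: mult_ac)
  then have "\<bar>1 - lam\<bar> * (real n / 8) \<le> L * sqrt (real n) * real k"
    using \<open>q > 0\<close> by (rule mult_right_le_imp_le)
  then have "real n * \<bar>1 - lam\<bar> \<le> sqrt (real n) * (8 * real k * L)"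
    by (simp add: mult_ac)
  moreover have "real n * \<bar>1 - lam\<bar> = sqrt (real n) * (\<bar>1 - lam\<bar> * sqrt (real n))"
    by simp
  ultimately have "sqrt (real n) * (\<bar>1 - lam\<bar> * sqrt (real n)) \<le> sqrt (real n) * (8 * real k * L)"
    by simp
  then have "\<bar>1 - lam\<bar> * sqrt (real n) \<le> 8 * real k * L"
    by (rule mult_left_le_imp_le) (use n0 in simp)
  then show ?thesis
    using n0 by (simp add: pos_le_divide_eq)
qed

section \<open>Size of the coboundary of the cochain\<close>

lemma exceptional_imp_exc_ext:
  assumes "exceptional H" "H \<subseteq> {..<n}"
  obtains v where "v \<in> H" "v \<in> exc_ext (H - {v})"
proof -
  consider "0 \<in> H" | T where "T \<subseteq> H" "T \<noteq> {}" "esym T = 0"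
    using assms(1) unfolding exceptional_def by blast
  then show thesis
  proof cases
    case 1
    then show ?thesis
      using that[of 0] assms(2) by (auto simp: exc_ext_def)
  next
    case 2
    then obtain v where v: "v \<in> T"
      by blast
    then have "esym (insert v (T - {v})) = 0" "T - {v} \<subseteq> H - {v}"
      using 2 by (auto simp: insert_absorb)
    then show ?thesis
      using that[of v] v 2 assms(2) unfolding exc_ext_def by blast
  qed
qed

lemma sign_cochain: "(if cochain G then -1 else 1) = \<chi> (xprod G)"
  using chi_pm[of "xprod G"] by (auto simp: cochain_def)

text \<open>A top face with nonzero coboundary has \<open>\<chi> (esym H) = -1\<close>, so it is in
  \<open>Y\<close> only as an exceptional set and arises from a facet \<open>F\<close> by adding one
  of at most \<open>r\<close> vertices. The resulting bound O(1/n) is sharper than the target with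
  the logarithm.\<close>

lemma norm2_cob2_cochain_le:
  "norm2 Y (k + 1) (cob2 Y k cochain) \<le> 8 * real (k + 1) * real r / real n"
proof -
  define N where "N = card (cfaces Y k)"
  define D where "D = card (cfaces Y (Suc k))"
  have n0: "real n \<ge> 1"
    using n_ge k_ge_2 by simp
  have "N > 0"
    unfolding N_def using card_cfaces_Y[of k] n_ge by simp
  have "{H \<in> cfaces Y (Suc k). cob2 Y k cochain H} \<subseteq> (\<Union>F\<in>cfaces Y k. (\<lambda>v. insert v F) ` exc_ext F)"
  proof
    fix H assume "H \<in> {H \<in> cfaces Y (Suc k). cob2 Y k cochain H}"
    then have H: "H \<in> cfaces Y (Suc k)" "cob2 Y k cochain H"
      by auto
    note H' = cfaces_Y_memD[OF H(1)]
    have "(if cob2 Y k cochain H then -1 else 1) = \<chi> (esym H)"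
      unfolding chi_esym sign_cochain[symmetric]
      using H' by (intro sign_cob2 in_Y_skeleton) auto
    then have "exceptional H"
      using H H' in_Y_top by auto
    then obtain v where v: "v \<in> H" "v \<in> exc_ext (H - {v})"
      using exceptional_imp_exc_ext H' by blast
    moreover have "H - {v} \<in> cfaces Y k"
      using H' v by (auto simp: cfaces_Y)
    ultimately show "H \<in> (\<Union>F\<in>cfaces Y k. (\<lambda>v. insert v F) ` exc_ext F)"
      by (intro UN_I[of "H - {v}"] image_eqI[of _ _ v]) auto
  qed
  then have "card {H \<in> cfaces Y (Suc k). cob2 Y k cochain H}
      \<le> card (\<Union>F\<in>cfaces Y k. (\<lambda>v. insert v F) ` exc_ext F)"
    by (intro card_mono) auto
  also have "\<dots> \<le> (\<Sum>F\<in>cfaces Y k. card ((\<lambda>v. insert v F) ` exc_ext F))"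
    by (intro card_UN_le) auto
  also have "\<dots> \<le> (\<Sum>F\<in>cfaces Y k. r)"
  proof (rule sum_mono)
    fix F assume F: "F \<in> cfaces Y k"
    have "card ((\<lambda>v. insert v F) ` exc_ext F) \<le> card (exc_ext F)"
      by (rule card_image_le) simp
    also have "\<dots> \<le> r"
      using cfaces_Y_memD[OF F] by (intro card_exc_ext_le) auto
    finally show "card ((\<lambda>v. insert v F) ` exc_ext F) \<le> r" .
  qed
  finally have "card {H \<in> cfaces Y (Suc k). cob2 Y k cochain H} \<le> N * r"
    by (simp add: N_def)
  then have num: "real (card {H \<in> cfaces Y (Suc k). cob2 Y k cochain H}) \<le> real N * real r"
    by (simp only: of_nat_mult[symmetric] of_nat_le_iff)
  \<comment> \<open>Counting incidences between facets and top faces in two ways bounds the number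
    \<open>D\<close> of top faces from below.\<close>
  have "real N * (real n / 8) \<le> (\<Sum>F\<in>cfaces Y k. real (deg Y k F))"
  proof -
    have "(\<Sum>F\<in>cfaces Y k. real n / 8) \<le> (\<Sum>F\<in>cfaces Y k. real (deg Y k F))"
      by (intro sum_mono deg_Y_ge) (auto dest: cfaces_Y_memD)
    then show ?thesis
      by (simp add: N_def)
  qed
  also have "\<dots> = (\<Sum>F\<in>cfaces Y k. \<Sum>H\<in>cfaces Y (Suc k). of_bool (F \<subseteq> H))"
    by (simp add: deg_def Int_def)
  also have "\<dots> = (\<Sum>H\<in>cfaces Y (Suc k). \<Sum>F\<in>cfaces Y k. of_bool (F \<subseteq> H))"
    by (rule sum.swap)
  also have "\<dots> = (\<Sum>H\<in>cfaces Y (Suc k). real (Suc k))"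
  proof (rule sum.cong)
    fix H assume H: "H \<in> cfaces Y (Suc k)"
    note H' = cfaces_Y_memD[OF H]
    have "cfaces Y k \<inter> {T. T \<subseteq> H} = {T. T \<subseteq> H \<and> card T = k}"
      using H' by (auto simp: cfaces_Y)
    then show "(\<Sum>F\<in>cfaces Y k. of_bool (F \<subseteq> H)) = real (Suc k)"
      using n_subsets[OF H'(3), of k] H' by simp
  qed simp
  also have "\<dots> = real D * real (Suc k)"
    by (simp add: D_def)
  finally have den: "real N * (real n / 8) / real (Suc k) \<le> real D"
    by (simp add: field_simps)
  have "norm2 Y (k + 1) (cob2 Y k cochain) \<le> real N * real r / (real N * (real n / 8) / real (Suc k))"
    unfolding norm2_def Suc_eq_plus1[symmetric] D_def[symmetric]
    using num den \<open>N > 0\<close> n0 by (intro frac_le) auto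
  also have "\<dots> = 8 * real (k + 1) * real r / real n"
    using \<open>N > 0\<close> n0 by (simp add: field_simps)
  finally show ?thesis .
qed

end

section \<open>Distance of the cochain from coboundaries\<close>

text \<open>Normalised correlation bounds. One Cauchy-Schwarz step bounds the square of a
  correlation by the proportion of pairs with equal labels, at most \<open>B / n\<close>, plus the
  correlation with one variable fewer.\<close>

fun box_eps :: "nat \<Rightarrow> nat \<Rightarrow> nat \<Rightarrow> real" where
  "box_eps B n 0 = real B / sqrt (real n)"
| "box_eps B n (Suc j) = sqrt (real B / real n + box_eps B n j)"

text \<open>The index \<open>j\<close> stands for lists of length \<open>j + 2\<close>: a product of bounded functions each ignoring one entry.\<close>
fun box_function :: "nat \<Rightarrow> (nat list \<Rightarrow> real) \<Rightarrow> bool" where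
  "box_function 0 \<Phi> \<longleftrightarrow> (\<exists>\<alpha> \<beta>. (\<forall>u. \<bar>\<alpha> u\<bar> \<le> 1 \<and> \<bar>\<beta> u\<bar> \<le> 1) \<and> (\<forall>u v. \<Phi> [u, v] = \<alpha> u * \<beta> v))"
| "box_function (Suc j) \<Phi> \<longleftrightarrow> (\<exists>\<psi> \<Theta>. (\<forall>ys. \<bar>\<psi> ys\<bar> \<le> 1) \<and> (\<forall>y. box_function j (\<Theta> y))
      \<and> (\<forall>y ys. \<Phi> (y # ys) = \<psi> ys * \<Theta> y ys))"

text \<open>The sign of the coboundary of a cochain with signs \<open>s\<close>, extended to lists
  with repetitions. The set \<open>S\<close> collects the entries already passed, so the factor
  split off at each step ignores the current entry.\<close>

fun gphase :: "(nat set \<Rightarrow> real) \<Rightarrow> nat set \<Rightarrow> nat list \<Rightarrow> real" where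
  "gphase s S [] = 1"
| "gphase s S (y # ys) = s (S \<union> set ys) * gphase s (insert y S) ys"

definition tuples :: "nat \<Rightarrow> nat \<Rightarrow> nat list set" where
  "tuples n j = {xs. set xs \<subseteq> {..<n} \<and> length xs = j}"

lemma finite_tuples [simp]: "finite (tuples n j)"
  unfolding tuples_def by (rule finite_lists_length_eq) simp

lemma card_tuples: "card (tuples n j) = n ^ j"
  unfolding tuples_def by (subst card_lists_length_eq) auto

lemma sum_tuples_0 [simp]: "(\<Sum>xs\<in>tuples n 0. f xs) = f []"
proof -
  have "tuples n 0 = {[]}"
    by (auto simp: tuples_def)
  then show ?thesis
    by simp
qed

lemma sum_tuples_Suc:
  "(\<Sum>xs\<in>tuples n (Suc j). f xs) = (\<Sum>y<n. \<Sum>ys\<in>tuples n j. f (y # ys))"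
  unfolding sum.cartesian_product
  by (rule sum.reindex_bij_witness[where i="\<lambda>(y, ys). y # ys" and j="\<lambda>xs. (hd xs, tl xs)"])
    (auto simp: tuples_def length_Suc_conv)

lemma box_eps_nonneg: "box_eps B n j \<ge> 0"
  by (induction j) auto

text \<open>Squaring in the Cauchy-Schwarz step produces products of two box functions of the same
  arity; this closure keeps the induction going.\<close>

lemma box_function_mult:
  "box_function j \<Phi> \<Longrightarrow> box_function j \<Phi>' \<Longrightarrow> box_function j (\<lambda>xs. \<Phi> xs * \<Phi>' xs)"
proof (induction j arbitrary: \<Phi> \<Phi>')
  case 0
  obtain \<alpha> \<beta> where 1: "\<forall>u. \<bar>\<alpha> u\<bar> \<le> 1 \<and> \<bar>\<beta> u\<bar> \<le> 1" "\<forall>u v. \<Phi> [u, v] = \<alpha> u * \<beta> v"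
    using 0(1) by auto
  obtain \<alpha>' \<beta>' where 2: "\<forall>u. \<bar>\<alpha>' u\<bar> \<le> 1 \<and> \<bar>\<beta>' u\<bar> \<le> 1" "\<forall>u v. \<Phi>' [u, v] = \<alpha>' u * \<beta>' v"
    using 0(2) by auto
  show ?case
    unfolding box_function.simps
    by (rule exI[of _ "\<lambda>u. \<alpha> u * \<alpha>' u"], rule exI[of _ "\<lambda>u. \<beta> u * \<beta>' u"])
      (use 1 2 in \<open>auto simp: abs_mult intro!: mult_le_one\<close>)
next
  case (Suc j)
  obtain \<psi> \<Theta> where 1: "\<forall>ys. \<bar>\<psi> ys\<bar> \<le> 1" "\<forall>y. box_function j (\<Theta> y)"
      "\<forall>y ys. \<Phi> (y # ys) = \<psi> ys * \<Theta> y ys"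
    using Suc(2) by auto
  obtain \<psi>' \<Theta>' where 2: "\<forall>ys. \<bar>\<psi>' ys\<bar> \<le> 1" "\<forall>y. box_function j (\<Theta>' y)"
      "\<forall>y ys. \<Phi>' (y # ys) = \<psi>' ys * \<Theta>' y ys"
    using Suc(3) by auto
  show ?case
    unfolding box_function.simps
    by (rule exI[of _ "\<lambda>ys. \<psi> ys * \<psi>' ys"], rule exI[of _ "\<lambda>y ys. \<Theta> y ys * \<Theta>' y ys"])
      (use 1 2 Suc.IH in \<open>auto simp: abs_mult intro!: mult_le_one\<close>)
qed

lemma box_function_le_1: "box_function j \<Phi> \<Longrightarrow> length xs = j + 2 \<Longrightarrow> \<bar>\<Phi> xs\<bar> \<le> 1"
proof (induction j arbitrary: \<Phi> xs)
  case 0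
  then obtain u v where "xs = [u, v]"
    by (auto simp: numeral_2_eq_2 length_Suc_conv)
  then show ?case
    using 0 by (auto simp: abs_mult intro!: mult_le_one)
next
  case (Suc j)
  then obtain y ys where xs: "xs = y # ys" "length ys = j + 2"
    by (auto simp: length_Suc_conv)
  obtain \<psi> \<Theta> where 1: "\<forall>ys. \<bar>\<psi> ys\<bar> \<le> 1" "\<forall>y. box_function j (\<Theta> y)"
      "\<forall>y ys. \<Phi> (y # ys) = \<psi> ys * \<Theta> y ys"
    using Suc(2) by auto
  then show ?case
    using Suc.IH[of "\<Theta> y" ys] xs by (auto simp: abs_mult intro!: mult_le_one)
qed

lemma box_function_gphase:
  assumes "\<And>G. \<bar>s G\<bar> \<le> 1"
  shows "box_function j (gphase s S)"
proof (induction j arbitrary: S)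
  case 0
  show ?case
    unfolding box_function.simps
    by (rule exI[of _ "\<lambda>u. s (insert u S)"], rule exI[of _ "\<lambda>v. s (S \<union> {v})"])
      (use assms in \<open>auto simp: mult.commute\<close>)
next
  case (Suc j)
  show ?case
    unfolding box_function.simps
    by (rule exI[of _ "\<lambda>ys. s (S \<union> set ys)"], rule exI[of _ "\<lambda>y. gphase s (insert y S)"])
      (use assms Suc in auto)
qed

lemma gphase_distinct:
  "distinct xs \<Longrightarrow> S \<inter> set xs = {} \<Longrightarrow> gphase s S xs = (\<Prod>w\<in>set xs. s (S \<union> (set xs - {w})))"
proof (induction xs arbitrary: S)
  case (Cons y ys)
  have "gphase s (insert y S) ys = (\<Prod>w\<in>set ys. s (insert y S \<union> (set ys - {w})))"
    using Cons by auto
  also have "\<dots> = (\<Prod>w\<in>set ys. s (S \<union> (set (y # ys) - {w})))"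
  proof (rule prod.cong)
    fix w assume "w \<in> set ys"
    then have "insert y S \<union> (set ys - {w}) = S \<union> (set (y # ys) - {w})"
      using Cons.prems by auto
    then show "s (insert y S \<union> (set ys - {w})) = s (S \<union> (set (y # ys) - {w}))"
      by simp
  qed simp
  moreover have "set (y # ys) - {y} = set ys"
    using Cons.prems by auto
  ultimately show ?case
    using Cons.prems by simp
qed simp

context character_complex
begin

section \<open>Correlation of the cochain with coboundaries\<close>

definition lprod :: "nat list \<Rightarrow> 'f" where
  "lprod xs = prod_list (map x xs)"

lemma lprod_K: "lprod xs \<in> K"
  unfolding lprod_def by (induction xs) (auto simp: one_K mult_K x_K)

lemma lprod_distinct: "distinct xs \<Longrightarrow> lprod xs = xprod (set xs)"
  by (simp add: lprod_def xprod_def prod.distinct_set_conv_list)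

text \<open>Cauchy--Schwarz over the entries other than the first removes the factor ignoring it.\<close>
lemma box_correlation_le:
  assumes "c \<in> K" "c \<noteq> 0" "box_function j \<Phi>"
  shows "\<bar>\<Sum>xs\<in>tuples n (j + 2). \<chi> (c * lprod xs) * \<Phi> xs\<bar> \<le> real n ^ (j + 2) * box_eps B n j"
  using assms
proof (induction j arbitrary: c \<Phi>)
  case 0
  obtain \<alpha> \<beta> where ab: "\<And>u. \<bar>\<alpha> u\<bar> \<le> 1" "\<And>u. \<bar>\<beta> u\<bar> \<le> 1" "\<And>u v. \<Phi> [u, v] = \<alpha> u * \<beta> v"
    using 0(3) by auto
  have n0: "real n > 0"
    using n_ge k_ge_2 by simp
  have sq: "sqrt (\<Sum>u<n. (\<gamma> u)\<^sup>2) \<le> sqrt (real n)" if "\<And>u. \<bar>\<gamma> u\<bar> \<le> 1" for \<gamma> :: "nat \<Rightarrow> real"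
  proof -
    have "(\<Sum>u<n. (\<gamma> u)\<^sup>2) \<le> (\<Sum>u<n. 1)"
      by (rule sum_mono) (use that in \<open>simp add: abs_square_le_1\<close>)
    then show ?thesis
      by simp
  qed
  have "(\<Sum>xs\<in>tuples n (0 + 2). \<chi> (c * lprod xs) * \<Phi> xs)
      = (\<Sum>u<n. \<Sum>v<n. \<chi> (c * x u * x v) * \<alpha> u * \<beta> v)"
    by (simp add: numeral_2_eq_2 sum_tuples_Suc ab lprod_def mult.assoc)
  also have "\<bar>\<dots>\<bar> \<le> real B * sqrt (real n) * sqrt (\<Sum>u<n. (\<alpha> u)\<^sup>2) * sqrt (\<Sum>v<n. (\<beta> v)\<^sup>2)"
    by (rule form_boundD, rule character_form_bound) (use 0 in auto)
  also have "\<dots> \<le> real B * sqrt (real n) * sqrt (real n) * sqrt (real n)"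
    by (intro mult_mono sq ab) (auto intro: sum_nonneg)
  also have "\<dots> = real n ^ (0 + 2) * box_eps B n 0"
    using n0 by (simp add: field_simps power2_eq_square)
  finally show ?case .
next
  case (Suc j)
  have n0: "real n > 0"
    using n_ge k_ge_2 by simp
  obtain \<psi> \<Theta> where psi: "\<And>ys. \<bar>\<psi> ys\<bar> \<le> 1" and theta: "\<And>y. box_function j (\<Theta> y)"
      and Phi: "\<And>y ys. \<Phi> (y # ys) = \<psi> ys * \<Theta> y ys"
    using Suc.prems(3) by auto
  define N where "N = real n ^ (j + 2)"
  have N: "N > 0" "N = real (card (tuples n (j + 2)))"
    using n0 by (auto simp: N_def card_tuples)
  define \<epsilon> where "\<epsilon> = box_eps B n j"
  \<comment> \<open>The factor \<open>\<psi>\<close> depends on \<open>ys\<close> alone, so it stays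
    outside \<open>W\<close> and is bounded by 1 after Cauchy-Schwarz.\<close>
  define W where "W ys = (\<Sum>y<n. \<chi> (c * x y * lprod ys) * \<Theta> y ys)" for ys
  have "(\<Sum>xs\<in>tuples n (Suc j + 2). \<chi> (c * lprod xs) * \<Phi> xs)
      = (\<Sum>y<n. \<Sum>ys\<in>tuples n (j + 2). \<psi> ys * (\<chi> (c * x y * lprod ys) * \<Theta> y ys))"
    by (simp add: sum_tuples_Suc[where j="j + 2", simplified] Phi lprod_def mult_ac)
  also have "\<dots> = (\<Sum>ys\<in>tuples n (j + 2). \<psi> ys * W ys)"
    by (subst sum.swap) (simp add: W_def sum_distrib_left)
  also have "\<bar>\<dots>\<bar> \<le> sqrt (\<Sum>ys\<in>tuples n (j + 2). (\<psi> ys)\<^sup>2) * sqrt (\<Sum>ys\<in>tuples n (j + 2). (W ys)\<^sup>2)"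
    by (rule Cauchy_Schwarz_sum)
  also have "\<dots> \<le> sqrt N * sqrt (N * (real n)\<^sup>2 * (real B / real n + \<epsilon>))"
  proof (intro mult_mono real_sqrt_le_mono)
    have "(\<Sum>ys\<in>tuples n (j + 2). (\<psi> ys)\<^sup>2) \<le> (\<Sum>ys\<in>tuples n (j + 2). 1)"
      by (rule sum_mono) (use psi in \<open>simp add: abs_square_le_1\<close>)
    then show "(\<Sum>ys\<in>tuples n (j + 2). (\<psi> ys)\<^sup>2) \<le> N"
      using N(2) by simp
    \<comment> \<open>Equal labels are estimated trivially. For different labels
      \<open>c * (x y + x z)\<close> is a nonzero twist, so the induction hypothesis
      applies.\<close>
    have inner: "(\<Sum>ys\<in>tuples n (j + 2). \<chi> (c * x y * lprod ys) * \<Theta> y ys * (\<chi> (c * x z * lprod ys) * \<Theta> z ys))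
        \<le> N * ((if x y = x z then 1 else 0) + \<epsilon>)" for y z
    proof -
      have "(\<Sum>ys\<in>tuples n (j + 2). \<chi> (c * x y * lprod ys) * \<Theta> y ys * (\<chi> (c * x z * lprod ys) * \<Theta> z ys))
          = (\<Sum>ys\<in>tuples n (j + 2). \<chi> (c * (x y + x z) * lprod ys) * (\<Theta> y ys * \<Theta> z ys))"
      proof (rule sum.cong)
        fix ys
        have "\<chi> (c * x y * lprod ys + c * x z * lprod ys) = \<chi> (c * x y * lprod ys) * \<chi> (c * x z * lprod ys)"
          using Suc.prems by (intro chi_add mult_K x_K lprod_K)
        then show "\<chi> (c * x y * lprod ys) * \<Theta> y ys * (\<chi> (c * x z * lprod ys) * \<Theta> z ys)
            = \<chi> (c * (x y + x z) * lprod ys) * (\<Theta> y ys * \<Theta> z ys)"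
          by (simp add: algebra_simps)
      qed simp
      also have "\<dots> \<le> N * ((if x y = x z then 1 else 0) + \<epsilon>)"
      proof (cases "x y = x z")
        case True
        have "(\<Sum>ys\<in>tuples n (j + 2). \<chi> (c * (x y + x z) * lprod ys) * (\<Theta> y ys * \<Theta> z ys))
            \<le> (\<Sum>ys\<in>tuples n (j + 2). 1)"
        proof (rule sum_mono)
          fix ys assume "ys \<in> tuples n (j + 2)"
          then have "length ys = j + 2"
            by (simp add: tuples_def)
          then have "\<bar>\<chi> (c * (x y + x z) * lprod ys) * (\<Theta> y ys * \<Theta> z ys)\<bar> \<le> 1"
            using box_function_le_1[OF theta[of y], of ys] box_function_le_1[OF theta[of z], of ys]
            by (auto simp: abs_mult intro!: mult_le_one)
          then show "\<chi> (c * (x y + x z) * lprod ys) * (\<Theta> y ys * \<Theta> z ys) \<le> 1"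
            by linarith
        qed
        also have "\<dots> = N"
          using N by simp
        also have "\<dots> \<le> N * (1 + \<epsilon>)"
          using N box_eps_nonneg[of B n j] by (simp add: \<epsilon>_def)
        finally show ?thesis
          using True by simp
      next
        case False
        then have "\<bar>\<Sum>ys\<in>tuples n (j + 2). \<chi> (c * (x y + x z) * lprod ys) * (\<Theta> y ys * \<Theta> z ys)\<bar> \<le> N * \<epsilon>"
          unfolding N_def \<epsilon>_def using Suc.prems theta
          by (intro Suc.IH box_function_mult) (auto simp: mult_K add_K x_K add_eq_0_iff_eq)
        then show ?thesis
          using False by simp
      qed
      finally show ?thesis .
    qed
    have "(\<Sum>ys\<in>tuples n (j + 2). (W ys)\<^sup>2) = (\<Sum>ys\<in>tuples n (j + 2). \<Sum>y<n. \<Sum>z<n.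
        \<chi> (c * x y * lprod ys) * \<Theta> y ys * (\<chi> (c * x z * lprod ys) * \<Theta> z ys))"
      by (simp add: W_def power2_eq_square sum_product)
    also have "\<dots> = (\<Sum>y<n. \<Sum>z<n. \<Sum>ys\<in>tuples n (j + 2).
        \<chi> (c * x y * lprod ys) * \<Theta> y ys * (\<chi> (c * x z * lprod ys) * \<Theta> z ys))"
      by (subst sum.swap, rule sum.cong[OF refl], rule sum.swap)
    also have "\<dots> \<le> (\<Sum>y<n. \<Sum>z<n. N * ((if x y = x z then 1 else 0) + \<epsilon>))"
      by (intro sum_mono inner)
    also have "\<dots> = (\<Sum>y<n. N * ((\<Sum>z<n. if x y = x z then 1 else 0) + real n * \<epsilon>))"
      by (simp add: sum_distrib_left[symmetric] sum.distrib)
    also have "\<dots> \<le> (\<Sum>y<n. N * (real B + real n * \<epsilon>))"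
    proof (intro sum_mono mult_left_mono add_right_mono)
      fix y
      have "(\<Sum>z<n. if x y = x z then 1 else 0) \<le> real B * (\<Sum>t\<in>K. if x y = t then 1 else 0)"
        by (rule sum_fibre_le[where \<phi> = "\<lambda>t. if x y = t then 1 else 0"]) auto
      then show "(\<Sum>z<n. if x y = x z then 1 else 0) \<le> real B"
        using finite_K x_K by simp
    qed (use N in auto)
    also have "\<dots> = real n * (N * (real n * (real B / real n) + real n * \<epsilon>))"
      using n0 by simp
    also have "\<dots> = N * (real n)\<^sup>2 * (real B / real n + \<epsilon>)"
      by (simp only: power2_eq_square distrib_left mult_ac)
    finally show "(\<Sum>ys\<in>tuples n (j + 2). (W ys)\<^sup>2) \<le> N * (real n)\<^sup>2 * (real B / real n + \<epsilon>)" .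
  qed (use N in \<open>auto intro: sum_nonneg\<close>)
  also have "\<dots> = sqrt N * sqrt N * real n * sqrt (real B / real n + \<epsilon>)"
    by (simp add: real_sqrt_mult)
  also have "\<dots> = real n ^ (Suc j + 2) * box_eps B n (Suc j)"
    using N n0 by (simp add: N_def \<epsilon>_def)
  finally show ?case .
qed

text \<open>For each \<open>g\<close>, the norm is half of 1 minus the average sign
  \<open>\<sigma>\<close>. That average is computed over ordered tuples, where the sign is a
  character times a box function; tuples with repeated entries are estimated trivially.\<close>

lemma cnorm2_cochain_ge:
  "cnorm2 Y k cochain \<ge> 1 - real n ^ k * (1 + box_eps B n (k - 2)) / (2 * fact k * real (n choose k))"
  unfolding cnorm2_def
proof (rule cInf_greatest)
  fix t assume "t \<in> {norm2 Y k (\<lambda>F. cochain F \<noteq> cob2 Y (k - 1) g F) | g. True}"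
  then obtain g where t: "t = norm2 Y k (\<lambda>F. cochain F \<noteq> cob2 Y (k - 1) g F)"
    by blast
  define s where "s G = (if g G then -1 else 1 :: real)" for G
  define \<sigma> where "\<sigma> F = \<chi> (xprod F) * (\<Prod>w\<in>F. s (F - {w}))" for F
  define M where "M = real (n choose k)"
  define D where "D = {xs \<in> tuples n k. distinct xs}"
  have k2: "k - 2 + 2 = k" "Suc (k - 1) = k"
    using k_ge_2 by auto
  have Mpos: "M > 0"
    using n_ge by (simp add: M_def)
  have M: "M = real (card (cfaces Y k))"
    by (simp add: M_def card_cfaces_Y)
  have sigma: "(if cochain F \<noteq> cob2 Y (k - 1) g F then -1 else 1) = \<sigma> F" if F: "F \<in> cfaces Y k" for F
  proof -
    note F' = cfaces_Y_memD[OF F]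
    have *: "(\<Prod>w\<in>F. s (F - {w})) = (if cob2 Y (k - 1) g F then -1 else 1)"
      unfolding s_def using F' k2 by (intro sign_cob2[symmetric] in_Y_skeleton) auto
    show ?thesis
      unfolding \<sigma>_def sign_cochain[symmetric] * by simp
  qed
  have "real (card {F \<in> cfaces Y k. cochain F \<noteq> cob2 Y (k - 1) g F})
      = (\<Sum>F\<in>cfaces Y k. of_bool (cochain F \<noteq> cob2 Y (k - 1) g F))"
    by (simp add: Int_def)
  also have "\<dots> = (\<Sum>F\<in>cfaces Y k. (1 - \<sigma> F) / 2)"
    by (rule sum.cong) (auto simp flip: sigma)
  also have "\<dots> = (M - (\<Sum>F\<in>cfaces Y k. \<sigma> F)) / 2"
    by (simp add: M sum_divide_distrib[symmetric] sum_subtractf)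
  finally have t_eq: "t = (M - (\<Sum>F\<in>cfaces Y k. \<sigma> F)) / 2 / M"
    by (simp only: t norm2_def M[symmetric])
  have fibre: "{xs \<in> D. set xs = F} = permutations_of_set F" if "F \<in> cfaces Y k" for F
    using cfaces_Y_memD[OF that]
    by (auto simp: D_def tuples_def permutations_of_set_def distinct_card)
  have cardD: "(\<Sum>xs\<in>D. \<tau> (set xs)) = fact k * (\<Sum>F\<in>cfaces Y k. \<tau> F)" for \<tau> :: "nat set \<Rightarrow> real"
  proof -
    have "(\<Sum>xs\<in>D. \<tau> (set xs)) = (\<Sum>F\<in>cfaces Y k. \<Sum>xs\<in>{xs \<in> D. set xs = F}. \<tau> (set xs))"
      by (rule sum.group[symmetric])
        (auto simp: D_def tuples_def cfaces_Y distinct_card intro: finite_subset[OF _ finite_tuples[of n k]])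
    also have "\<dots> = (\<Sum>F\<in>cfaces Y k. fact k * \<tau> F)"
    proof (rule sum.cong)
      fix F assume F: "F \<in> cfaces Y k"
      have "(\<Sum>xs\<in>{xs \<in> D. set xs = F}. \<tau> (set xs)) = (\<Sum>xs\<in>permutations_of_set F. \<tau> F)"
        by (rule sum.cong) (use fibre[OF F] in auto)
      also have "\<dots> = fact k * \<tau> F"
        using cfaces_Y_memD[OF F] by simp
      finally show "(\<Sum>xs\<in>{xs \<in> D. set xs = F}. \<tau> (set xs)) = fact k * \<tau> F" .
    qed simp
    finally show ?thesis
      by (simp add: sum_distrib_left)
  qed
  have finD: "finite D" "D \<subseteq> tuples n k"
    by (auto simp: D_def)
  have cD: "real (card D) = fact k * M"
    using cardD[of "\<lambda>_. 1"] by (simp add: M)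
  \<comment> \<open>The factor 1 matches the twist \<open>c = 1\<close> in
    \<open>box_correlation_le\<close>.\<close>
  define \<Phi> where "\<Phi> xs = \<chi> (1 * lprod xs) * gphase s {} xs" for xs
  have s1: "\<bar>s G\<bar> \<le> 1" for G
    by (simp add: s_def)
  have Phi1: "\<bar>\<Phi> xs\<bar> \<le> 1" if "xs \<in> tuples n k" for xs
    using that box_function_le_1[OF box_function_gphase[OF s1, where j="k - 2"], of xs] k2
    by (simp add: \<Phi>_def abs_mult tuples_def)
  have "fact k * (\<Sum>F\<in>cfaces Y k. \<sigma> F) = (\<Sum>xs\<in>D. \<sigma> (set xs))"
    by (rule cardD[symmetric])
  also have "\<dots> = (\<Sum>xs\<in>D. \<Phi> xs)"
    by (rule sum.cong) (auto simp: D_def \<sigma>_def \<Phi>_def lprod_distinct gphase_distinct)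
  \<comment> \<open>The correlation bound needs all tuples; the \<open>n ^ k - fact k * M\<close>
    added ones have a repeated entry and contribute at most 1 each.\<close>
  also have "\<dots> = (\<Sum>xs\<in>tuples n k. \<Phi> xs) - (\<Sum>xs\<in>tuples n k - D. \<Phi> xs)"
    using finD by (simp add: sum_diff)
  also have "\<dots> \<le> real n ^ k * box_eps B n (k - 2) + (real n ^ k - fact k * M)"
  proof -
    have "\<bar>\<Sum>xs\<in>tuples n (k - 2 + 2). \<chi> (1 * lprod xs) * gphase s {} xs\<bar>
        \<le> real n ^ (k - 2 + 2) * box_eps B n (k - 2)"
      by (rule box_correlation_le[OF one_K one_neq_zero box_function_gphase[OF s1]])
    then have "\<bar>\<Sum>xs\<in>tuples n k. \<Phi> xs\<bar> \<le> real n ^ k * box_eps B n (k - 2)"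
      by (simp only: k2 \<Phi>_def)
    moreover have "\<bar>\<Sum>xs\<in>tuples n k - D. \<Phi> xs\<bar> \<le> (\<Sum>xs\<in>tuples n k - D. 1)"
      by (rule order_trans[OF sum_abs], rule sum_mono, rule Phi1) simp
    moreover have "real (card (tuples n k - D)) = real (card (tuples n k)) - real (card D)"
      using finD by (simp add: card_Diff_subset card_mono of_nat_diff)
    then have "(\<Sum>xs\<in>tuples n k - D. 1) = real n ^ k - fact k * M"
      by (simp add: card_tuples cD)
    ultimately show ?thesis
      by linarith
  qed
  finally have "fact k * (\<Sum>F\<in>cfaces Y k. \<sigma> F)
      \<le> real n ^ k * box_eps B n (k - 2) + (real n ^ k - fact k * M)" .
  then have "((\<Sum>F\<in>cfaces Y k. \<sigma> F) + M) * fact k \<le> real n ^ k * (1 + box_eps B n (k - 2))"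
    by (simp only: distrib_left distrib_right mult_1_right mult.commute[of _ "fact k"])
  moreover define a where "a = real n ^ k * (1 + box_eps B n (k - 2)) / fact k"
  ultimately have "(\<Sum>F\<in>cfaces Y k. \<sigma> F) + M \<le> a"
    by (simp only: pos_le_divide_eq fact_gt_zero)
  then have "t \<ge> (M - (a - M)) / 2 / M"
    unfolding t_eq using Mpos by (intro divide_right_mono) auto
  also have "(M - (a - M)) / 2 / M = 1 - a / (2 * M)"
    using Mpos by (simp add: field_simps)
  also have "a / (2 * M) = real n ^ k * (1 + box_eps B n (k - 2)) / (2 * fact k * real (n choose k))"
    by (simp add: a_def M_def mult_ac)
  finally show "1 - real n ^ k * (1 + box_eps B n (k - 2)) / (2 * fact k * real (n choose k)) \<le> t" .
qed blast

end

section \<open>Existence\<close>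

text \<open>The labels run periodically through the nonzero field elements, so fibres are bounded
  and each full period has character sum -1.\<close>

lemma character_complex_exists:
  assumes k: "k \<ge> 2" and n: "n \<ge> 8 * k" "n \<ge> 128"
  obtains K :: "bit alg_closure set" and \<chi> and x where "character_complex K \<chi> k n 32 x"
proof -
  have "1 \<le> n div 8"
    using n by simp
  then obtain m where m: "2 ^ m \<le> n div 8" "n div 8 < 2 ^ (m + 1)"
    using ex_power_ivl1[of 2 "n div 8"] by auto
  define N :: nat where "N = 2 ^ m"
  have N: "8 * N \<le> n" "n < 16 * N"
    using m by (auto simp: N_def)
  have "m \<noteq> 0"
    using N n by (auto simp: N_def intro!: Nat.gr0I)
  then obtain K :: "bit alg_closure set" and \<chi> where bfc: "binary_field_character K \<chi>" and cK: "card K = N"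
    using binary_field_character_exists[of m] by (auto simp: N_def)
  interpret binary_field_character K \<chi>
    by (rule bfc)
  \<comment> \<open>From \<open>n < 16 * N\<close> and \<open>N \<le> 2 * p\<close> follows
    \<open>n < 32 * p\<close>: there are fewer than 32 full periods, and 32 bounds the
    fibres.\<close>
  define p where "p = N - 1"
  have p: "p > 0" "n < 32 * p" "p < N"
    using N n by (auto simp: p_def)
  have "card (K - {0}) = p"
    using cK zero_K finite_K by (simp add: p_def)
  then obtain e where e: "bij_betw e {..<p} (K - {0})"
    using ex_bij_betw_nat_finite[of "K - {0}"] finite_K by (auto simp: atLeast0LessThan)
  define x where "x v = e (v mod p)" for v
  have x: "x v \<in> K - {0}" for v
    using bij_betwE[OF e] p by (simp add: x_def)
  have fibre: "card {v. v < n \<and> x v = t} \<le> 32" for t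
  proof -
    have "inj_on (\<lambda>v. v div p) {v. v < n \<and> x v = t}"
    proof (rule inj_onI)
      fix v w assume vw: "v \<in> {v. v < n \<and> x v = t}" "w \<in> {v. v < n \<and> x v = t}" "v div p = w div p"
      then have "v mod p = w mod p"
        using bij_betw_imp_inj_on[OF e] p by (auto simp: x_def inj_on_def)
      with vw(3) show "v = w"
        by (metis div_mult_mod_eq)
    qed
    moreover have "(\<lambda>v. v div p) ` {v. v < n \<and> x v = t} \<subseteq> {..<32}"
      using p by (auto simp: less_mult_imp_div_less)
    ultimately show ?thesis
      using card_inj_on_le[of "\<lambda>v. v div p" _ "{..<32::nat}"] by simp
  qed
  \<comment> \<open>The full periods contribute less than 32 in absolute value and the incomplete
    one less than \<open>p\<close>, hence less than \<open>n / 8\<close>; \<open>n \<ge> 128\<close>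
    makes the total at most \<open>n / 2\<close>.\<close>
  have equi: "\<bar>\<Sum>v<n. \<chi> (c * x v)\<bar> \<le> real n / 2" if c: "c \<in> K" "c \<noteq> 0" for c
  proof -
    define q where "q = n div p"
    have chi0: "\<chi> 0 = 1"
      using chi_add[OF zero_K zero_K] chi_pm[of 0] by auto
    have "(\<Sum>i<p. \<chi> (c * e i)) = (\<Sum>t\<in>K - {0}. \<chi> (c * t))"
      by (rule sum.reindex_bij_betw[OF e])
    also have "\<dots> = -1"
      using chi_sum[OF c] chi0 finite_K zero_K by (simp add: sum_diff1)
    finally have period: "(\<Sum>i<p. \<chi> (c * e i)) = -1" .
    have "(\<Sum>v<q * p. \<chi> (c * x v)) = (\<Sum>j<q. \<Sum>v\<in>{j * p..<j * p + p}. \<chi> (c * x v))"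
      by (rule sum.nat_group[symmetric])
    also have "\<dots> = (\<Sum>j<q. \<Sum>i<p. \<chi> (c * e i))"
    proof (rule sum.cong)
      fix j
      show "(\<Sum>v\<in>{j * p..<j * p + p}. \<chi> (c * x v)) = (\<Sum>i<p. \<chi> (c * e i))"
        using sum.shift_bounds_nat_ivl[of "\<lambda>v. \<chi> (c * x v)" 0 "j * p" p]
        by (simp add: x_def add.commute[of p] atLeast0LessThan)
    qed simp
    also have "\<dots> = - real q"
      by (simp add: period)
    finally have main: "(\<Sum>v<q * p. \<chi> (c * x v)) = - real q" .
    have qp: "q * p \<le> n" "n - q * p < p"
      using p by (auto simp: q_def minus_div_mult_eq_mod)
    have "(\<Sum>v<n. \<chi> (c * x v)) = (\<Sum>v<q * p. \<chi> (c * x v)) + (\<Sum>v\<in>{q * p..<n}. \<chi> (c * x v))"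
      using qp by (simp add: lessThan_atLeast0 sum.atLeastLessThan_concat)
    moreover have "\<bar>\<Sum>v\<in>{q * p..<n}. \<chi> (c * x v)\<bar> \<le> (\<Sum>v\<in>{q * p..<n}. 1)"
      by (rule order_trans[OF sum_abs], rule sum_mono) (metis chi_pm abs_1 abs_minus order_refl)
    moreover have "(\<Sum>v\<in>{q * p..<n}. 1) = real (n - q * p)"
      by simp
    moreover have "q < 32"
      using p by (simp add: q_def less_mult_imp_div_less)
    ultimately show ?thesis
      using main N(1) n p qp(2) by linarith
  qed
  have "character_complex K \<chi> k n 32 x"
    by unfold_locales (use assms x fibre equi cK N in auto)
  then show thesis
    by (rule that)
qed

section \<open>Limits and assembly of the family\<close>

lemma box_eps_tendsto_0: "(\<lambda>n. box_eps B n j) \<longlonglongrightarrow> 0"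
proof (induction j)
  case 0
  have "filterlim (\<lambda>n. sqrt (real n)) at_top sequentially"
    by (rule filterlim_compose[OF sqrt_at_top filterlim_real_sequentially])
  then show ?case
    by (auto intro!: tendsto_divide_0[OF tendsto_const] filterlim_at_top_imp_at_infinity)
next
  case (Suc j)
  have "(\<lambda>n. sqrt (real B / real n + box_eps B n j)) \<longlonglongrightarrow> sqrt (0 + 0)"
    by (intro tendsto_real_sqrt tendsto_add lim_const_over_n Suc)
  then show ?case
    by simp
qed

lemma power_over_binomial_tendsto_1: "(\<lambda>n. real n ^ k / (fact k * real (n choose k))) \<longlonglongrightarrow> 1"
proof -
  have eq: "fact k * real (n choose k) / real n ^ k = (\<Prod>i<k. (real n - real i) / real n)" for n
    by (simp add: binomial_gbinomial gbinomial_prod_rev prod_dividef atLeast0LessThan)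
  have "(\<lambda>n. (real n - real i) / real n) \<longlonglongrightarrow> 1" for i
  proof -
    have "(\<lambda>n. 1 - real i / real n) \<longlonglongrightarrow> 1 - 0"
      by (intro tendsto_diff tendsto_const lim_const_over_n)
    moreover have "\<forall>\<^sub>F n in sequentially. 1 - real i / real n = (real n - real i) / real n"
      using eventually_gt_at_top[of 0] by eventually_elim (simp add: diff_divide_distrib)
    ultimately show ?thesis
      by (simp add: tendsto_cong)
  qed
  then have "(\<lambda>n. \<Prod>i<k. (real n - real i) / real n) \<longlonglongrightarrow> (\<Prod>i<k. 1)"
    by (intro tendsto_prod)
  then have "(\<lambda>n. fact k * real (n choose k) / real n ^ k) \<longlonglongrightarrow> 1"
    unfolding eq by simp
  then have "(\<lambda>n. inverse (fact k * real (n choose k) / real n ^ k)) \<longlonglongrightarrow> inverse 1"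
    by (intro tendsto_inverse) auto
  then show ?thesis
    by simp
qed

theorem theorem1p4:
  fixes k :: nat
  assumes "k \<ge> 2"
  shows "\<exists>C>0. \<exists>(Y :: nat \<Rightarrow> nat set set) (a :: nat \<Rightarrow> nat set \<Rightarrow> bool).
    (\<forall>\<^sub>F n in sequentially.
        simplicial_complex n (Y n) \<and> pure_dim k (Y n) \<and> complete_skeleton n k (Y n)
      \<and> (\<forall>lam. nontrivial_eig (Y n) k lam \<longrightarrow>
            1 - C / sqrt (real n) \<le> lam \<and> lam \<le> 1 + C / sqrt (real n))
      \<and> norm2 (Y n) (k + 1) (cob2 (Y n) k (a n)) \<le> C * ln (real n) / real n
      \<and> (\<forall>i\<le>k - 1. reduced_hom_vanishes (Y n) i))
    \<and> (\<forall>\<epsilon>>0. \<forall>\<^sub>F n in sequentially. cnorm2 (Y n) k (a n) \<ge> 1 / 2 - \<epsilon>)"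
proof -
  define C where "C = max (8 * real k * link_const k 32) (8 * real (k + 1) * real (exc_const k 32))"
  define low where "low n = 1 - real n ^ k * (1 + box_eps 32 n (k - 2)) / (2 * fact k * real (n choose k))" for n
  \<comment> \<open>Including the explicit lower bound \<open>low n\<close> lets one choice of
    complex and cochain for each \<open>n\<close> serve both the finite statements and the
    limit.\<close>
  define good where "good n \<Delta> a \<longleftrightarrow> simplicial_complex n \<Delta> \<and> pure_dim k \<Delta> \<and> complete_skeleton n k \<Delta>
      \<and> (\<forall>lam. nontrivial_eig \<Delta> k lam \<longrightarrow>
            1 - C / sqrt (real n) \<le> lam \<and> lam \<le> 1 + C / sqrt (real n))
      \<and> norm2 \<Delta> (k + 1) (cob2 \<Delta> k a) \<le> C * ln (real n) / real n
      \<and> (\<forall>i\<le>k - 1. reduced_hom_vanishes \<Delta> i) \<and> low n \<le> cnorm2 \<Delta> k a" for n \<Delta> a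
  have "0 < 8 * real (k + 1) * real (exc_const k 32)"
    by (simp add: exc_const_def add_pos_nonneg)
  then have "C > 0"
    unfolding C_def by linarith
  have ex: "\<exists>\<Delta> a. good n \<Delta> a" if n: "n \<ge> 8 * k + 128" for n
  proof -
    obtain K :: "bit alg_closure set" and \<chi> and x where cc: "character_complex K \<chi> k n 32 x"
      using character_complex_exists[of k n] assms n by auto
    interpret character_complex K \<chi> k n 32 x
      by (rule cc)
    have "good n Y cochain"
      unfolding good_def
    proof (intro conjI allI impI)
      fix lam assume "nontrivial_eig Y k lam"
      then have "\<bar>1 - lam\<bar> \<le> 8 * real k * link_const k 32 / sqrt (real n)"
        by (rule nontrivial_eig_near_1)
      also have "\<dots> \<le> C / sqrt (real n)"
        by (intro divide_right_mono) (auto simp: C_def)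
      finally show "1 - C / sqrt (real n) \<le> lam" "lam \<le> 1 + C / sqrt (real n)"
        by linarith+
    next
      \<comment> \<open>With \<open>ln n\<close> at least 1, the bound \<open>C / n\<close> implies
        the required \<open>C * ln n / n\<close>.\<close>
      have "exp 1 \<le> real n"
        using n exp_le by linarith
      then have "1 \<le> ln (real n)"
        using n by (simp add: ln_ge_iff)
      have "norm2 Y (k + 1) (cob2 Y k cochain) \<le> 8 * real (k + 1) * real (exc_const k 32) / real n"
        by (rule norm2_cob2_cochain_le)
      also have "\<dots> \<le> C / real n"
        by (intro divide_right_mono) (auto simp: C_def)
      also have "\<dots> \<le> C * ln (real n) / real n"
        using \<open>C > 0\<close> \<open>1 \<le> ln (real n)\<close> by (intro divide_right_mono) auto
      finally show "norm2 Y (k + 1) (cob2 Y k cochain) \<le> C * ln (real n) / real n" .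
      show "low n \<le> cnorm2 Y k cochain"
        unfolding low_def by (rule cnorm2_cochain_ge)
    qed (use simplicial_complex_Y pure_dim_Y complete_skeleton_Y reduced_hom_vanishes_Y in auto)
    then show ?thesis
      by blast
  qed
  then obtain Y a where Ya: "\<And>n. n \<ge> 8 * k + 128 \<Longrightarrow> good n (Y n) (a n)"
    by metis
  have ev: "\<forall>\<^sub>F n in sequentially. good n (Y n) (a n)"
    using eventually_ge_at_top[of "8 * k + 128"] by eventually_elim (rule Ya)
  have "(\<lambda>n. 1 - real n ^ k / (fact k * real (n choose k)) * (1 + box_eps 32 n (k - 2)) / 2)
      \<longlonglongrightarrow> 1 - 1 * (1 + 0) / 2"
    by (intro tendsto_intros power_over_binomial_tendsto_1 box_eps_tendsto_0) auto
  then have low: "low \<longlonglongrightarrow> 1 / 2"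
    by (simp add: low_def[abs_def] mult_ac)
  have "\<forall>\<^sub>F n in sequentially. cnorm2 (Y n) k (a n) \<ge> 1 / 2 - \<epsilon>" if "\<epsilon> > 0" for \<epsilon>
  proof -
    have "\<forall>\<^sub>F n in sequentially. low n > 1 / 2 - \<epsilon>"
      using order_tendstoD(1)[OF low, of "1 / 2 - \<epsilon>"] that by simp
    with ev show ?thesis
      by eventually_elim (auto simp: good_def)
  qed
  moreover have "\<forall>\<^sub>F n in sequentially.
        simplicial_complex n (Y n) \<and> pure_dim k (Y n) \<and> complete_skeleton n k (Y n)
      \<and> (\<forall>lam. nontrivial_eig (Y n) k lam \<longrightarrow>
            1 - C / sqrt (real n) \<le> lam \<and> lam \<le> 1 + C / sqrt (real n))
      \<and> norm2 (Y n) (k + 1) (cob2 (Y n) k (a n)) \<le> C * ln (real n) / real n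
      \<and> (\<forall>i\<le>k - 1. reduced_hom_vanishes (Y n) i)"
    using ev by eventually_elim (auto simp: good_def)
  ultimately show ?thesis
    using \<open>C > 0\<close> by blast
qed

end
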